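(* Let $\mathbf n=(n_k)_{k\ge1}$ be a strictly increasing sequence of positive integers with $\mathbf n\ne\mathbb N$. There exists a $1$-unconditional Schauder basis $\mathcal B$ (of some Banach space) that is $\omega$-($\mathbf n$, strong partially greedy) for some weight on sets $\omega$, but $\mathcal B$ is not $\zeta$-($\mathbf n$, strong partially greedy) for any weight sequence $\zeta$.
   Context: Banach spaces are separable, infinite-dimensional, over $\mathbb F=\mathbb R$ or $\mathbb C$; $\mathbb N=\{1,2,\dots\}$. A basis of $X$ is a sequence $\mathcal B=(e_n)_{n\ge1}\subset X$ whose linear span is norm-dense and for which there is a sequence $(e_n^* )_{n\ge1}\subset X^*$ with $e_j^*(e_k)=\delta_{j,k}$ and $0<\inf_n\{\|e_n\|,\|e_n^*\|\}\le\sup_n\{\|e_n\|,\|e_n^*\|\}<\infty$. It is Schauder if moreover the span of $(e_n^* )$ is weak$^*$-dense in $X^*$ and there is $K$ with $\|\sum_{n=1}^me_n^*(x)e_n\|\le K\|x\|$ for all $x\in X$, $m\in\mathbb N$. It is $1$-unconditional if for all $N\in\mathbb N$, $\|\sum_{n=1}^Na_ne_n\|\le\|\sum_{n=1}^Nb_ne_n\|$ whenever $|a_n|\le|b_n|$ for $1\le n\le N$. The sequence $\mathbf n$ is identified with its set of terms. A weight on sets is a function $\omega:\mathcal P(\mathbb N)\to[0,\infty]$ on the power set of $\mathbb N$ with $\omega(\emptyset)=0$ and $\omega(A)\in(0,\infty]$ for each nonempty $A\subset\mathbb N$. A weight sequence is $\zeta=(s_n)_{n\ge1}\in(0,\infty)^{\mathbb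 N}$; it induces the weight on sets $\zeta(A)=\sum_{n\in A}s_n$, and $\zeta$-($\mathbf n$, strong partially greedy) means $\omega$-($\mathbf n$, strong partially greedy) for this induced weight. For finite $A\subset\mathbb N$, $P_A(x)=\sum_{n\in A}e_n^*(x)e_n$. For $x\in X$, $m\in\mathbb N$, a greedy set of $x$ of order $m$ is a set $A\subset\mathbb N$ with $|A|=m$ and $\min_{n\in A}|e_n^*(x)|\ge\max_{n\notin A}|e_n^*(x)|$. Let $B_0=\emptyset$ and $B_m=\{n_1,\dots,n_m\}$ for $m\ge1$. $\mathcal B$ is $\omega$-($\mathbf n$, strong partially greedy) if there is $C\ge1$ such that for all $x\in X$, $m\in\mathbb N$ and every greedy set $A$ of $x$ of order $m$, $\|x-P_A(x)\|\le C\,\widehat\sigma^{\mathbf n,\omega}_A(x)$, where $\widehat\sigma^{\mathbf n,\omega}_A(x)=\inf\{\|x-P_{B_k}(x)\|:k\ge0,\ \omega(B_k\setminus A)\le\omega(A\setminus B_k)\}$. *)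

theory Defs
  imports "HOL-Analysis.Analysis" "HOL-Library.Function_Algebras"
begin

text \<open>
  A normed space is a linear subspace \<open>vecs\<close> of an ambient vector space with
  underlying group \<open>'v\<close>, together with a norm on \<open>vecs\<close>; values of \<open>nrm\<close> off \<open>vecs\<close> are
  irrelevant. HOL cannot quantify existentially over types, so "some Banach space" is rendered as
  "some such structure with \<open>'v = nat \<Rightarrow> 'f\<close>". No separable Banach space over \<open>'f\<close> is lost: it has
  Hamel dimension at most the continuum, which is the dimension of \<open>nat \<Rightarrow> 'f\<close>, so it embeds
  linearly in \<open>nat \<Rightarrow> 'f\<close> and its norm can be transported along the embedding.
\<close>

record ('f, 'v) normed_structure =
  scal :: "'f \<Rightarrow> 'v \<Rightarrow> 'v"
  vecs :: "'v set"
  nrm :: "'v \<Rightarrow> real"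

definition normed_space :: "('f::real_normed_field, 'v::ab_group_add) normed_structure \<Rightarrow> bool" where
  "normed_space X \<longleftrightarrow>
     vector_space (scal X) \<and> module.subspace (scal X) (vecs X) \<and>
     (\<forall>x\<in>vecs X. 0 \<le> nrm X x) \<and>
     (\<forall>x\<in>vecs X. nrm X x = 0 \<longleftrightarrow> x = 0) \<and>
     (\<forall>c. \<forall>x\<in>vecs X. nrm X (scal X c x) = norm c * nrm X x) \<and>
     (\<forall>x\<in>vecs X. \<forall>y\<in>vecs X. nrm X (x + y) \<le> nrm X x + nrm X y)"

text \<open>The value 0 off \<open>vecs\<close> is there because \<^locale>\<open>Metric_space\<close> asks for nonnegativity and
  symmetry on the whole type.\<close>

definition nrm_dist :: "('f, 'v::ab_group_add) normed_structure \<Rightarrow> 'v \<Rightarrow> 'v \<Rightarrow> real" where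
  "nrm_dist X x y = (if x \<in> vecs X \<and> y \<in> vecs X then nrm X (x - y) else 0)"

lemma normed_space_Metric_space:
  assumes "normed_space X"
  shows "Metric_space (vecs X) (nrm_dist X)"
proof -
  interpret vector_space "scal X" using assms by (simp add: normed_space_def)
  have sub: "subspace (vecs X)"
    and nonneg: "\<And>x. x \<in> vecs X \<Longrightarrow> 0 \<le> nrm X x"
    and zero: "\<And>x. x \<in> vecs X \<Longrightarrow> nrm X x = 0 \<longleftrightarrow> x = 0"
    and hom: "\<And>c x. x \<in> vecs X \<Longrightarrow> nrm X (scal X c x) = norm c * nrm X x"
    and add: "\<And>x y. x \<in> vecs X \<Longrightarrow> y \<in> vecs X \<Longrightarrow> nrm X (x + y) \<le> nrm X x + nrm X y"
    using assms by (simp_all add: normed_space_def)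
  have diff: "x - y \<in> vecs X" if "x \<in> vecs X" "y \<in> vecs X" for x y
    using subspace_diff[OF sub that] .
  have minus: "nrm X (y - x) = nrm X (x - y)" if "x \<in> vecs X" "y \<in> vecs X" for x y
    using hom[OF diff[OF that], of "- 1"] by simp
  have tri: "nrm X (x - z) \<le> nrm X (x - y) + nrm X (y - z)"
    if "x \<in> vecs X" "y \<in> vecs X" "z \<in> vecs X" for x y z
    using add[OF diff[OF that(1,2)] diff[OF that(2,3)]] by simp
  show ?thesis
  proof (rule Metric_space.intro)
    show "0 \<le> nrm_dist X x y" for x y
      by (simp add: nrm_dist_def nonneg diff)
    show "nrm_dist X x y = nrm_dist X y x" for x y
      by (simp add: nrm_dist_def minus)
    show "nrm_dist X x y = 0 \<longleftrightarrow> x = y" if "x \<in> vecs X" "y \<in> vecs X" for x y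
      by (simp add: nrm_dist_def zero diff that)
    show "nrm_dist X x z \<le> nrm_dist X x y + nrm_dist X y z"
      if "x \<in> vecs X" "y \<in> vecs X" "z \<in> vecs X" for x y z
      by (simp add: nrm_dist_def tri that)
  qed
qed

abbreviation norm_topology :: "('f, 'v::ab_group_add) normed_structure \<Rightarrow> 'v topology" where
  "norm_topology X \<equiv> Metric_space.mtopology (vecs X) (nrm_dist X)"

definition infinite_dimensional :: "('f::real_normed_field, 'v::ab_group_add) normed_structure \<Rightarrow> bool" where
  "infinite_dimensional X \<longleftrightarrow>
     \<not> (\<exists>S. finite S \<and> S \<subseteq> vecs X \<and> module.span (scal X) S = vecs X)"

definition banach_space :: "('f::real_normed_field, 'v::ab_group_add) normed_structure \<Rightarrow> bool" where
  "banach_space X \<longleftrightarrow>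
     normed_space X \<and> Metric_space.mcomplete (vecs X) (nrm_dist X) \<and>
     separable_space (norm_topology X) \<and> infinite_dimensional X"

text \<open>Functionals are represented by functions vanishing off \<open>vecs\<close>, so that each bounded functional
  has exactly one representative and the dual is closed under pointwise linear combinations.\<close>

definition dual :: "('f::real_normed_field, 'v::ab_group_add) normed_structure \<Rightarrow> ('v \<Rightarrow> 'f) set" where
  "dual X = {f. (\<forall>x\<in>vecs X. \<forall>y\<in>vecs X. f (x + y) = f x + f y) \<and>
                (\<forall>c. \<forall>x\<in>vecs X. f (scal X c x) = c * f x) \<and>
                (\<exists>K. \<forall>x\<in>vecs X. norm (f x) \<le> K * nrm X x) \<and>
                (\<forall>x. x \<notin> vecs X \<longrightarrow> f x = 0)}"

definition dual_norm :: "('f::real_normed_field, 'v::ab_group_add) normed_structure \<Rightarrow> ('v \<Rightarrow> 'f) \<Rightarrow> real" where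
  "dual_norm X f = (SUP x\<in>{x \<in> vecs X. nrm X x \<le> 1}. norm (f x))"

definition weak_star :: "('f::real_normed_field, 'v::ab_group_add) normed_structure \<Rightarrow> ('v \<Rightarrow> 'f) topology" where
  "weak_star X = topology_generated_by
     {{f \<in> dual X. f x \<in> U} | x U. x \<in> vecs X \<and> open U}"

lemma topspace_weak_star:
  assumes "normed_space X"
  shows "topspace (weak_star X) = dual X"
proof -
  interpret vector_space "scal X" using assms by (simp add: normed_space_def)
  have "0 \<in> vecs X" using assms subspace_0 by (auto simp: normed_space_def)
  then show ?thesis
    unfolding weak_star_def topology_generated_by_topspace by (auto intro: open_UNIV)
qed

text \<open>Sequences are indexed by the positive naturals \<open>{1..}\<close>; their entries at 0 are never used.
  The coordinate functionals \<open>es\<close> are carried along explicitly; they are determined by \<open>e\<close>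
  on the positive indices, since the span of \<open>e\<close> is dense.\<close>

definition basis :: "('f::real_normed_field, 'v::ab_group_add) normed_structure \<Rightarrow> (nat \<Rightarrow> 'v) \<Rightarrow> (nat \<Rightarrow> 'v \<Rightarrow> 'f) \<Rightarrow> bool" where
  "basis X e es \<longleftrightarrow>
     (\<forall>n\<ge>1. e n \<in> vecs X) \<and>
     norm_topology X closure_of module.span (scal X) (e ` {1..}) = vecs X \<and>
     (\<forall>n\<ge>1. es n \<in> dual X) \<and>
     (\<forall>j\<ge>1. \<forall>k\<ge>1. es j (e k) = (if j = k then 1 else 0)) \<and>
     0 < Inf ((\<lambda>n. nrm X (e n)) ` {1..} \<union> (\<lambda>n. dual_norm X (es n)) ` {1..}) \<and>
     bdd_above ((\<lambda>n. nrm X (e n)) ` {1..} \<union> (\<lambda>n. dual_norm X (es n)) ` {1..})"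

definition proj :: "('f, 'v::ab_group_add) normed_structure \<Rightarrow> (nat \<Rightarrow> 'v) \<Rightarrow> (nat \<Rightarrow> 'v \<Rightarrow> 'f) \<Rightarrow> nat set \<Rightarrow> 'v \<Rightarrow> 'v" where
  "proj X e es A x = (\<Sum>n\<in>A. scal X (es n x) (e n))"

definition schauder_basis :: "('f::real_normed_field, 'v::ab_group_add) normed_structure \<Rightarrow> (nat \<Rightarrow> 'v) \<Rightarrow> (nat \<Rightarrow> 'v \<Rightarrow> 'f) \<Rightarrow> bool" where
  "schauder_basis X e es \<longleftrightarrow>
     basis X e es \<and>
     weak_star X closure_of module.span (\<lambda>c f x. c * f x) (es ` {1..}) = dual X \<and>
     (\<exists>K. \<forall>x\<in>vecs X. \<forall>m\<ge>1. nrm X (\<Sum>n=1..m. scal X (es n x) (e n)) \<le> K * nrm X x)"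

definition one_unconditional :: "('f::real_normed_field, 'v::ab_group_add) normed_structure \<Rightarrow> (nat \<Rightarrow> 'v) \<Rightarrow> bool" where
  "one_unconditional X e \<longleftrightarrow>
     (\<forall>N\<ge>1. \<forall>a b. (\<forall>n\<in>{1..N}. norm (a n) \<le> norm (b n)) \<longrightarrow>
        nrm X (\<Sum>n=1..N. scal X (a n) (e n)) \<le> nrm X (\<Sum>n=1..N. scal X (b n) (e n)))"

definition set_weight :: "(nat set \<Rightarrow> ennreal) \<Rightarrow> bool" where
  "set_weight \<omega> \<longleftrightarrow> \<omega> {} = 0 \<and> (\<forall>A\<subseteq>{1..}. A \<noteq> {} \<longrightarrow> 0 < \<omega> A)"

definition weight_sequence :: "(nat \<Rightarrow> real) \<Rightarrow> bool" where
  "weight_sequence s \<longleftrightarrow> (\<forall>n\<ge>1. 0 < s n)"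

definition induced_weight :: "(nat \<Rightarrow> real) \<Rightarrow> nat set \<Rightarrow> ennreal" where
  "induced_weight s A = (\<Sum>\<^sub>\<infinity>n\<in>A. ennreal (s n))"

lemma induced_weight_finite: "finite A \<Longrightarrow> induced_weight s A = (\<Sum>n\<in>A. ennreal (s n))"
  by (simp add: induced_weight_def)

definition greedy_set :: "(nat \<Rightarrow> 'v \<Rightarrow> 'f::real_normed_field) \<Rightarrow> 'v \<Rightarrow> nat \<Rightarrow> nat set \<Rightarrow> bool" where
  "greedy_set es x m A \<longleftrightarrow>
     A \<subseteq> {1..} \<and> finite A \<and> card A = m \<and>
     (\<forall>i\<in>A. \<forall>j\<in>{1..} - A. norm (es j x) \<le> norm (es i x))"

definition initial_set :: "(nat \<Rightarrow> nat) \<Rightarrow> nat \<Rightarrow> nat set" where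
  "initial_set nn k = nn ` {1..k}"

definition sigma_hat :: "('f::real_normed_field, 'v::ab_group_add) normed_structure \<Rightarrow> (nat \<Rightarrow> 'v) \<Rightarrow> (nat \<Rightarrow> 'v \<Rightarrow> 'f)
    \<Rightarrow> (nat \<Rightarrow> nat) \<Rightarrow> (nat set \<Rightarrow> ennreal) \<Rightarrow> nat set \<Rightarrow> 'v \<Rightarrow> real" where
  "sigma_hat X e es nn \<omega> A x =
     Inf {nrm X (x - proj X e es (initial_set nn k) x) | k.
            \<omega> (initial_set nn k - A) \<le> \<omega> (A - initial_set nn k)}"

definition strong_partially_greedy :: "('f::real_normed_field, 'v::ab_group_add) normed_structure \<Rightarrow> (nat \<Rightarrow> 'v) \<Rightarrow> (nat \<Rightarrow> 'v \<Rightarrow> 'f)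
    \<Rightarrow> (nat \<Rightarrow> nat) \<Rightarrow> (nat set \<Rightarrow> ennreal) \<Rightarrow> bool" where
  "strong_partially_greedy X e es nn \<omega> \<longleftrightarrow>
     (\<exists>C\<ge>1. \<forall>x\<in>vecs X. \<forall>m\<ge>1. \<forall>A. greedy_set es x m A \<longrightarrow>
        nrm X (x - proj X e es A x) \<le> C * sigma_hat X e es nn \<omega> A x)"

end

theory Submission
  imports Defs
begin

text \<open>
  Given a family \<open>F\<close> of finite sets covering the positive integers, the combinatorial space of \<open>F\<close> is
  the completion of the finitely supported sequences under
  \<open>\<parallel>x\<parallel> = sup {\<Sum>n\<in>S. \<bar>x n\<bar> | S \<in> F}\<close>. As the norm depends monotonically on the moduli of the
  coordinates, the unit vectors are a normalized 1-unconditional Schauder basis.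

  For every such basis the set weight \<open>\<omega> A = \<parallel>1\<^sub>A\<parallel>\<close> works, with constant 2 and for every sequence
  \<open>\<^bold>n\<close>. Let \<open>A\<close> be a greedy set of \<open>x\<close>, let \<open>B = B\<^sub>k\<close>, and let \<open>t\<close> be the smallest modulus of a
  coordinate of \<open>x\<close> on \<open>A\<close>. On \<open>B - A\<close> the coordinates of \<open>x\<close> have modulus at most \<open>t\<close>, on \<open>A - B\<close>
  at least \<open>t\<close>; so \<open>\<omega> (B - A) \<le> \<omega> (A - B)\<close> bounds the part of \<open>x - P\<^sub>A x\<close> living on \<open>B - A\<close> by
  \<open>\<parallel>x - P\<^sub>B x\<parallel>\<close>. The other part of \<open>x - P\<^sub>A x\<close> is a restriction of \<open>x - P\<^sub>B x\<close>.

  To exclude all weight sequences, split the positive integers into infinitely many rows, each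
  meeting \<open>\<^bold>n\<close> in an infinite set, and let \<open>F\<close> consist of the finite sets with at most one element in
  each row. This is the space \<open>\<ell>\<^sub>1(c\<^sub>0)\<close>: the norm of \<open>1\<^sub>A\<close> is the number of rows that \<open>A\<close> meets.
  Suppose the property held for a weight sequence \<open>s\<close> with constant \<open>C\<close>. Testing it on \<open>1\<^sub>B + 1\<^sub>E\<close> with
  greedy set \<open>E \<union> (B - D)\<close> gives \<open>\<parallel>1\<^sub>D\<parallel> \<le> C \<parallel>1\<^sub>E\<parallel>\<close> whenever \<open>D \<subseteq> B = B\<^sub>k\<close>, \<open>E \<inter> B = {}\<close> and
  \<open>s(D) \<le> s(E)\<close>. This fails for any \<open>s\<close>, because there are such \<open>D\<close> and \<open>E\<close> with \<open>D\<close> meeting \<open>M\<close> rows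
  and \<open>E\<close> inside a single row (\<open>exists_light_long_set\<close>). If some row has infinite weight along \<open>\<^bold>n\<close>,
  take for \<open>D\<close> elements of \<open>M\<close> different rows and for \<open>E\<close> a late and heavy piece of that row.
  Otherwise each row contains elements of \<open>\<^bold>n\<close> of arbitrarily small weight, and one can take
  \<open>E = {p}\<close> with \<open>p \<notin> \<^bold>n\<close> and choose for \<open>D\<close> one element of weight at most \<open>s\<^sub>p / M\<close> from each of \<open>M\<close> rows.
  This is where \<open>\<^bold>n \<noteq> \<nat>\<close> enters.
\<close>

section \<open>Combinatorial sequence spaces\<close>

lemma sum_fun_apply: "(\<Sum>i\<in>A. f i) x = (\<Sum>i\<in>A. f i x :: 'a::comm_monoid_add)"
  by (induction A rule: infinite_finite_induct) auto

definition comb_norm :: "nat set set \<Rightarrow> (nat \<Rightarrow> 'f::real_normed_field) \<Rightarrow> real" where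
  "comb_norm F x = (SUP S\<in>F. \<Sum>n\<in>S. norm (x n))"

text \<open>
  The sequences whose tails tend to 0 in norm, that is, the closure of the finitely supported ones.
  The condition on the tails also makes the supremum in \<open>comb_norm\<close> finite. The entry at 0 has to
  vanish, as the norm does not see it.
\<close>

definition comb_vecs :: "nat set set \<Rightarrow> (nat \<Rightarrow> 'f::real_normed_field) set" where
  "comb_vecs F = {x. x 0 = 0 \<and> (\<forall>\<epsilon>>0. \<exists>N. \<forall>S\<in>F. (\<Sum>n\<in>S \<inter> {N..}. norm (x n)) \<le> \<epsilon>)}"

definition comb_space :: "nat set set \<Rightarrow> ('f::real_normed_field, nat \<Rightarrow> 'f) normed_structure" where
  "comb_space F = \<lparr>scal = (\<lambda>c x n. c * x n), vecs = comb_vecs F, nrm = comb_norm F\<rparr>"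

lemma comb_space_simps [simp]:
  "scal (comb_space F) = (\<lambda>c x n. c * x n)"
  "vecs (comb_space F) = comb_vecs F"
  "nrm (comb_space F) = comb_norm F"
  by (simp_all add: comb_space_def)

definition unit_vec :: "nat \<Rightarrow> nat \<Rightarrow> 'f::real_normed_field" where
  "unit_vec n m = (if m = n then 1 else 0)"

definition coord :: "nat set set \<Rightarrow> nat \<Rightarrow> (nat \<Rightarrow> 'f::real_normed_field) \<Rightarrow> 'f" where
  "coord F n x = (if x \<in> comb_vecs F then x n else 0)"

definition trunc :: "nat set \<Rightarrow> (nat \<Rightarrow> 'f::real_normed_field) \<Rightarrow> nat \<Rightarrow> 'f" where
  "trunc A x = (\<lambda>n. if n \<in> A then x n else 0)"

lemma sum_unit_vec:
  assumes "finite A"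
  shows "(\<Sum>n\<in>A. (\<lambda>m. a n * unit_vec n m)) = trunc A a"
  using assms by (auto simp: fun_eq_iff sum_fun_apply unit_vec_def trunc_def if_distrib cong: if_cong)

lemma sum_scal_unit_vec:
  assumes "finite A"
  shows "(\<Sum>n\<in>A. scal (comb_space F) (a n) (unit_vec n)) = trunc A a"
  using sum_unit_vec[OF assms] by simp

lemma trunc_unit: "trunc {n} (\<lambda>_. 1) = unit_vec n"
  by (auto simp: trunc_def unit_vec_def)

lemma inj_unit_vec: "inj (unit_vec :: nat \<Rightarrow> nat \<Rightarrow> 'f::real_normed_field)"
  by (rule injI) (metis unit_vec_def zero_neq_one)

lemma vector_space_pointwise: "vector_space (\<lambda>(c::'f::field) (x::'a \<Rightarrow> 'f) n. c * x n)"
  by unfold_locales (auto simp: fun_eq_iff algebra_simps)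

lemma comb_vecs_0_index: "x \<in> comb_vecs F \<Longrightarrow> x 0 = 0"
  by (simp add: comb_vecs_def)

lemma comb_vecsD:
  "x \<in> comb_vecs F \<Longrightarrow> \<epsilon> > 0 \<Longrightarrow> \<exists>N. \<forall>S\<in>F. (\<Sum>n\<in>S \<inter> {N..}. norm (x n)) \<le> \<epsilon>"
  unfolding comb_vecs_def by blast

text \<open>
  Convergence in a topology given by a subbase need only be tested on the subbase. It serves to show
  that a sequence converges weak*.
\<close>

lemma eventually_in_generated_open:
  fixes g :: "nat \<Rightarrow> 'b"
  assumes "generate_topology_on \<S> U" "f \<in> U"
    and "\<And>V. V \<in> \<S> \<Longrightarrow> f \<in> V \<Longrightarrow> eventually (\<lambda>m. g m \<in> V) sequentially"
  shows "eventually (\<lambda>m. g m \<in> U) sequentially"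
  using assms(1,2)
proof (induction rule: generate_topology_on.induct)
  case (Int a b)
  then show ?case by (auto intro: eventually_conj)
next
  case (UN K)
  then obtain k where "k \<in> K" "f \<in> k" by blast
  then have "eventually (\<lambda>m. g m \<in> k) sequentially" using UN.IH by blast
  then show ?case by (rule eventually_mono) (use \<open>k \<in> K\<close> in blast)
qed (use assms(3) in auto)

locale finite_cover =
  fixes F :: "nat set set"
  assumes finite_members: "S \<in> F \<Longrightarrow> finite S"
    and members_pos: "S \<in> F \<Longrightarrow> S \<subseteq> {1..}"
    and covers: "n \<ge> 1 \<Longrightarrow> \<exists>S\<in>F. n \<in> S"
begin

lemma nonempty: "F \<noteq> {}"
  using covers[of 1] by auto

text \<open>Small tails leave only finitely many coordinates, and each of these is bounded.\<close>

lemma comb_norm_bdd: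
  assumes "x \<in> comb_vecs F"
  shows "bdd_above ((\<lambda>S. \<Sum>n\<in>S. norm (x n)) ` F)"
proof -
  obtain N where N: "\<And>S. S \<in> F \<Longrightarrow> (\<Sum>n\<in>S \<inter> {N..}. norm (x n)) \<le> 1"
    using comb_vecsD[OF assms zero_less_one] by blast
  have "(\<Sum>n\<in>S. norm (x n)) \<le> 1 + (\<Sum>n<N. norm (x n))" if S: "S \<in> F" for S
  proof -
    have "(\<Sum>n\<in>S. norm (x n)) = (\<Sum>n\<in>S \<inter> {N..}. norm (x n)) + (\<Sum>n\<in>S - {N..}. norm (x n))"
      using finite_members[OF S] by (metis sum.Int_Diff)
    moreover have "(\<Sum>n\<in>S - {N..}. norm (x n)) \<le> (\<Sum>n<N. norm (x n))"
      by (rule sum_mono2) auto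
    ultimately show ?thesis using N[OF S] by simp
  qed
  then show ?thesis by (auto simp: bdd_above_def)
qed

lemma sum_le_comb_norm: "x \<in> comb_vecs F \<Longrightarrow> S \<in> F \<Longrightarrow> (\<Sum>n\<in>S. norm (x n)) \<le> comb_norm F x"
  unfolding comb_norm_def by (rule cSUP_upper[OF _ comb_norm_bdd])

lemma comb_norm_le: "(\<And>S. S \<in> F \<Longrightarrow> (\<Sum>n\<in>S. norm (x n)) \<le> c) \<Longrightarrow> comb_norm F x \<le> c"
  unfolding comb_norm_def using nonempty by (rule cSUP_least)

lemma comb_norm_nonneg: "x \<in> comb_vecs F \<Longrightarrow> 0 \<le> comb_norm F x"
  using nonempty sum_le_comb_norm[of x] by (meson ex_in_conv norm_ge_zero order_trans sum_nonneg)

lemma coord_le_comb_norm: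
  assumes "x \<in> comb_vecs F" 
  shows "norm (x n) \<le> comb_norm F x"
proof (cases "n = 0")
  case True
  then show ?thesis using assms comb_norm_nonneg[OF assms] by (simp add: comb_vecs_def)
next
  case False
  then obtain S where S: "S \<in> F" "n \<in> S" using covers[of n] by auto
  have "norm (x n) \<le> (\<Sum>n\<in>S. norm (x n))"
    using S finite_members by (intro member_le_sum) auto
  then show ?thesis using sum_le_comb_norm[OF assms S(1)] by simp
qed

text \<open>
  This lemma and the next are the source of unconditionality: membership and norm are monotone in
  the moduli of the coordinates.
\<close>

lemma comb_vecs_dominated:
  assumes "y \<in> comb_vecs F" and "\<And>n. norm (x n) \<le> norm (y n)"
  shows "x \<in> comb_vecs F"
proof -
  have "\<exists>N. \<forall>S\<in>F. (\<Sum>n\<in>S \<inter> {N..}. norm (x n)) \<le> \<epsilon>" if "\<epsilon> > 0" for \<epsilon>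
  proof -
    obtain N where N: "\<And>S. S \<in> F \<Longrightarrow> (\<Sum>n\<in>S \<inter> {N..}. norm (y n)) \<le> \<epsilon>"
      using comb_vecsD[OF assms(1) \<open>\<epsilon> > 0\<close>] by blast
    then have "(\<Sum>n\<in>S \<inter> {N..}. norm (x n)) \<le> \<epsilon>" if "S \<in> F" for S
      by (rule order_trans[OF sum_mono[OF assms(2)]]) (use N that in blast)
    then show ?thesis by blast
  qed
  moreover have "x 0 = 0" using assms(2)[of 0] assms(1) by (simp add: comb_vecs_def)
  ultimately show ?thesis by (simp add: comb_vecs_def)
qed

lemma comb_norm_mono:
  assumes "y \<in> comb_vecs F" and "\<And>n. norm (x n) \<le> norm (y n)"
  shows "comb_norm F x \<le> comb_norm F y"
  by (rule comb_norm_le) (rule order_trans[OF sum_mono[OF assms(2)] sum_le_comb_norm[OF assms(1)]])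

lemma comb_vecs_0: "0 \<in> comb_vecs F"
  by (auto simp: comb_vecs_def)

lemma comb_vecs_add:
  assumes "x \<in> comb_vecs F" "y \<in> comb_vecs F"
  shows "x + y \<in> comb_vecs F"
proof -
  have "\<exists>N. \<forall>S\<in>F. (\<Sum>n\<in>S \<inter> {N..}. norm ((x + y) n)) \<le> \<epsilon>" if "\<epsilon> > 0" for \<epsilon>
  proof -
    obtain N where N: "\<And>S. S \<in> F \<Longrightarrow> (\<Sum>n\<in>S \<inter> {N..}. norm (x n)) \<le> \<epsilon>/2"
      using comb_vecsD[OF assms(1) half_gt_zero[OF \<open>\<epsilon> > 0\<close>]] by blast
    obtain M where M: "\<And>S. S \<in> F \<Longrightarrow> (\<Sum>n\<in>S \<inter> {M..}. norm (y n)) \<le> \<epsilon>/2"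
      using comb_vecsD[OF assms(2) half_gt_zero[OF \<open>\<epsilon> > 0\<close>]] by blast
    have "(\<Sum>n\<in>S \<inter> {max N M..}. norm ((x + y) n)) \<le> \<epsilon>" if "S \<in> F" for S
    proof -
      have "(\<Sum>n\<in>S \<inter> {max N M..}. norm ((x + y) n)) \<le>
          (\<Sum>n\<in>S \<inter> {max N M..}. norm (x n) + norm (y n))"
        by (rule sum_mono) (simp add: norm_triangle_ineq)
      also have "\<dots> = (\<Sum>n\<in>S \<inter> {max N M..}. norm (x n)) + (\<Sum>n\<in>S \<inter> {max N M..}. norm (y n))"
        by (rule sum.distrib)
      also have "\<dots> \<le> (\<Sum>n\<in>S \<inter> {N..}. norm (x n)) + (\<Sum>n\<in>S \<inter> {M..}. norm (y n))"
        using finite_members[OF that] by (intro add_mono sum_mono2) auto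
      finally show ?thesis using N[OF that] M[OF that] by simp
    qed
    then show ?thesis by blast
  qed
  then show ?thesis using assms by (simp add: comb_vecs_def)
qed

lemma comb_vecs_scale:
  assumes "x \<in> comb_vecs F"
  shows "(\<lambda>n. c * x n) \<in> comb_vecs F"
proof -
  have "\<exists>N. \<forall>S\<in>F. (\<Sum>n\<in>S \<inter> {N..}. norm (c * x n)) \<le> \<epsilon>" if "\<epsilon> > 0" for \<epsilon>
  proof -
    have "\<epsilon> / (norm c + 1) > 0" using that by (simp add: add_nonneg_pos)
    then obtain N where N: "\<And>S. S \<in> F \<Longrightarrow> (\<Sum>n\<in>S \<inter> {N..}. norm (x n)) \<le> \<epsilon> / (norm c + 1)"
      using comb_vecsD[OF assms] by metis
    have "(\<Sum>n\<in>S \<inter> {N..}. norm (c * x n)) \<le> \<epsilon>" if S: "S \<in> F" for S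
    proof -
      have "(\<Sum>n\<in>S \<inter> {N..}. norm (c * x n)) = norm c * (\<Sum>n\<in>S \<inter> {N..}. norm (x n))"
        by (simp add: norm_mult sum_distrib_left)
      also have "\<dots> \<le> (norm c + 1) * (\<epsilon> / (norm c + 1))"
        by (intro mult_mono N[OF S]) (auto intro: sum_nonneg)
      also have "\<dots> = \<epsilon>" using norm_ge_zero[of c] by (simp add: add_nonneg_eq_0_iff)
      finally show ?thesis .
    qed
    then show ?thesis by blast
  qed
  then show ?thesis using assms by (simp add: comb_vecs_def)
qed

lemma comb_vecs_diff:
  assumes "x \<in> comb_vecs F" "y \<in> comb_vecs F"
  shows "x - y \<in> comb_vecs F"
proof -
  have "x - y = x + (\<lambda>n. (-1) * y n)" by (simp add: fun_eq_iff)
  then show ?thesis using comb_vecs_add[OF assms(1) comb_vecs_scale[OF assms(2)]] by metis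
qed

lemma comb_norm_add:
  assumes "x \<in> comb_vecs F" "y \<in> comb_vecs F"
  shows "comb_norm F (x + y) \<le> comb_norm F x + comb_norm F y"
proof (rule comb_norm_le)
  fix S assume S: "S \<in> F"
  have "(\<Sum>n\<in>S. norm ((x + y) n)) \<le> (\<Sum>n\<in>S. norm (x n) + norm (y n))"
    by (rule sum_mono) (simp add: norm_triangle_ineq)
  also have "\<dots> = (\<Sum>n\<in>S. norm (x n)) + (\<Sum>n\<in>S. norm (y n))" by (rule sum.distrib)
  finally show "(\<Sum>n\<in>S. norm ((x + y) n)) \<le> comb_norm F x + comb_norm F y"
    using sum_le_comb_norm[OF assms(1) S] sum_le_comb_norm[OF assms(2) S] by simp
qed

lemma comb_norm_scale: "x \<in> comb_vecs F \<Longrightarrow> comb_norm F (\<lambda>n. c * x n) = norm c * comb_norm F x"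
proof (rule antisym)
  assume x: "x \<in> comb_vecs F"
  have le: "(\<Sum>n\<in>S. norm (c * x n)) = norm c * (\<Sum>n\<in>S. norm (x n))" for S
    by (simp add: norm_mult sum_distrib_left)
  show "comb_norm F (\<lambda>n. c * x n) \<le> norm c * comb_norm F x"
    using sum_le_comb_norm[OF x] by (intro comb_norm_le) (simp add: le mult_left_mono)
  show "norm c * comb_norm F x \<le> comb_norm F (\<lambda>n. c * x n)"
  proof (cases "c = 0")
    case True
    then show ?thesis using comb_norm_nonneg[OF comb_vecs_scale[OF x, of c]] by simp
  next
    case False
    have "comb_norm F x \<le> comb_norm F (\<lambda>n. c * x n) / norm c"
    proof (rule comb_norm_le)
      fix S assume "S \<in> F"
      then have "norm c * (\<Sum>n\<in>S. norm (x n)) \<le> comb_norm F (\<lambda>n. c * x n)"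
        using sum_le_comb_norm[OF comb_vecs_scale[OF x, of c]] le by simp
      then show "(\<Sum>n\<in>S. norm (x n)) \<le> comb_norm F (\<lambda>n. c * x n) / norm c"
        using False by (simp add: field_simps)
    qed
    then show ?thesis using False by (simp add: field_simps)
  qed
qed

lemma comb_norm_eq_0_iff:
  assumes "x \<in> comb_vecs F" shows "comb_norm F x = 0 \<longleftrightarrow> x = 0"
proof
  assume "comb_norm F x = 0"
  then show "x = 0" using coord_le_comb_norm[OF assms] by (simp add: fun_eq_iff)
next
  assume "x = 0"
  then show "comb_norm F x = 0" using nonempty by (simp add: comb_norm_def)
qed

lemma trunc_in_comb_vecs_finite:
  assumes "finite A" "A \<subseteq> {1..}"
  shows "trunc A x \<in> comb_vecs F"
proof -
  have "(\<Sum>n\<in>S \<inter> {Suc (Max A)..}. norm (trunc A x n)) = 0" for S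
  proof (intro sum.neutral ballI)
    fix n assume "n \<in> S \<inter> {Suc (Max A)..}"
    then have "n \<notin> A" using Max_ge[OF assms(1), of n] by auto
    then show "norm (trunc A x n) = 0" by (simp add: trunc_def)
  qed
  moreover have "trunc A x 0 = 0" using assms(2) by (auto simp: trunc_def)
  ultimately show ?thesis unfolding comb_vecs_def
    by (auto intro!: exI[of _ "Suc (Max A)"] simp: less_imp_le)
qed

lemma comb_vecs_tail:
  assumes "x \<in> comb_vecs F" "\<epsilon> > 0"
  shows "\<exists>N. \<forall>m\<ge>N. comb_norm F (x - trunc {1..m} x) \<le> \<epsilon>"
proof -
  obtain N where N: "\<And>S. S \<in> F \<Longrightarrow> (\<Sum>n\<in>S \<inter> {N..}. norm (x n)) \<le> \<epsilon>"
    using comb_vecsD[OF assms] by blast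
  have "comb_norm F (x - trunc {1..m} x) \<le> \<epsilon>" if "m \<ge> N" for m
  proof (rule comb_norm_le)
    fix S assume S: "S \<in> F"
    have "(\<Sum>n\<in>S. norm ((x - trunc {1..m} x) n)) = (\<Sum>n\<in>S \<inter> {Suc m..}. norm (x n))"
      using finite_members[OF S] members_pos[OF S]
      by (intro sum.mono_neutral_cong_right) (auto simp: trunc_def)
    also have "\<dots> \<le> (\<Sum>n\<in>S \<inter> {N..}. norm (x n))"
      using that finite_members[OF S] by (intro sum_mono2) auto
    finally show "(\<Sum>n\<in>S. norm ((x - trunc {1..m} x) n)) \<le> \<epsilon>" using N[OF S] by simp
  qed
  then show ?thesis by blast
qed

lemma normed_space_comb_space:
  "normed_space (comb_space F :: ('f::real_normed_field, nat \<Rightarrow> 'f) normed_structure)"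
proof -
  interpret vector_space "\<lambda>(c::'f) (x::nat \<Rightarrow> 'f) n. c * x n" by (rule vector_space_pointwise)
  have "subspace (comb_vecs F)"
    by (rule subspaceI) (auto intro: comb_vecs_0 comb_vecs_add comb_vecs_scale)
  then show ?thesis
    by (simp add: normed_space_def vector_space_axioms comb_norm_nonneg comb_norm_eq_0_iff
        comb_norm_scale comb_norm_add)
qed

lemma metric: "Metric_space (comb_vecs F) (nrm_dist (comb_space F))"
  using normed_space_Metric_space[OF normed_space_comb_space] by simp

lemma nrm_dist_comb_space:
  "x \<in> comb_vecs F \<Longrightarrow> y \<in> comb_vecs F \<Longrightarrow> nrm_dist (comb_space F) x y = comb_norm F (x - y)"
  by (simp add: nrm_dist_def)

lemma unit_vec_in_comb_vecs: "n \<ge> 1 \<Longrightarrow> unit_vec n \<in> comb_vecs F"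
  using trunc_in_comb_vecs_finite[of "{n}" "\<lambda>_. 1"] by (simp add: trunc_unit)

lemma comb_norm_unit_vec:
  assumes "n \<ge> 1"
  shows "comb_norm F (unit_vec n :: nat \<Rightarrow> 'f::real_normed_field) = 1"
proof (rule antisym)
  show "comb_norm F (unit_vec n :: nat \<Rightarrow> 'f) \<le> 1"
  proof (rule comb_norm_le)
    fix S assume "S \<in> F"
    then show "(\<Sum>m\<in>S. norm (unit_vec n m :: 'f)) \<le> 1"
      using finite_members by (simp add: unit_vec_def if_distrib cong: if_cong)
  qed
  show "1 \<le> comb_norm F (unit_vec n :: nat \<Rightarrow> 'f)"
    using coord_le_comb_norm[OF unit_vec_in_comb_vecs[OF assms, where ?'a='f], of n]
    by (simp add: unit_vec_def)
qed

text \<open>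
  The coordinates of a Cauchy sequence converge, since each is bounded by the norm. The Cauchy
  estimate passes to the limit in every sum over one finite set \<open>S \<in> F\<close>, hence uniformly in \<open>S\<close>;
  that gives both the small tails of the limit and the convergence in norm.
\<close>

lemma mcomplete_comb_space:
  "Metric_space.mcomplete (comb_vecs F)
     (nrm_dist (comb_space F :: ('f::{real_normed_field,banach}, nat \<Rightarrow> 'f) normed_structure))"
proof -
  interpret metric: Metric_space "comb_vecs F :: (nat \<Rightarrow> 'f) set" "nrm_dist (comb_space F)"
    by (rule metric)
  show ?thesis
    unfolding metric.mcomplete_def
  proof (intro allI impI)
    fix \<sigma> :: "nat \<Rightarrow> nat \<Rightarrow> 'f"
    assume "metric.MCauchy \<sigma>"
    then have mem: "\<And>i. \<sigma> i \<in> comb_vecs F"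
      and "\<And>\<epsilon>. \<epsilon> > 0 \<Longrightarrow> \<exists>N. \<forall>i j. N \<le> i \<longrightarrow> N \<le> j \<longrightarrow> nrm_dist (comb_space F) (\<sigma> i) (\<sigma> j) < \<epsilon>"
      by (auto simp: metric.MCauchy_def)
    then have cauchy: "\<And>\<epsilon>. \<epsilon> > 0 \<Longrightarrow> \<exists>N. \<forall>i\<ge>N. \<forall>j\<ge>N. comb_norm F (\<sigma> i - \<sigma> j) < \<epsilon>"
      by (simp add: nrm_dist_comb_space)
    have "Cauchy (\<lambda>i. \<sigma> i n)" for n
    proof (rule CauchyI)
      fix \<epsilon> :: real assume "\<epsilon> > 0"
      then obtain N where N: "\<forall>i\<ge>N. \<forall>j\<ge>N. comb_norm F (\<sigma> i - \<sigma> j) < \<epsilon>" using cauchy by blast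
      have "norm (\<sigma> i n - \<sigma> j n) < \<epsilon>" if "i \<ge> N" "j \<ge> N" for i j
        using le_less_trans[OF coord_le_comb_norm[OF comb_vecs_diff[OF mem[of i] mem[of j]], of n]]
          N that by simp
      then show "\<exists>N. \<forall>i\<ge>N. \<forall>j\<ge>N. norm (\<sigma> i n - \<sigma> j n) < \<epsilon>" by blast
    qed
    then have "\<exists>l. (\<lambda>i. \<sigma> i n) \<longlonglongrightarrow> l" for n
      by (simp add: Cauchy_convergent_iff convergent_def)
    then obtain x where x: "\<And>n. (\<lambda>i. \<sigma> i n) \<longlonglongrightarrow> x n" by metis
    have close: "\<exists>N. \<forall>i\<ge>N. \<forall>S\<in>F. (\<Sum>n\<in>S. norm (\<sigma> i n - x n)) \<le> \<epsilon>" if "\<epsilon> > 0" for \<epsilon>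
    proof -
      obtain N where N: "\<forall>i\<ge>N. \<forall>j\<ge>N. comb_norm F (\<sigma> i - \<sigma> j) < \<epsilon>" using cauchy \<open>\<epsilon> > 0\<close> by blast
      have "(\<Sum>n\<in>S. norm (\<sigma> i n - x n)) \<le> \<epsilon>" if i: "i \<ge> N" and S: "S \<in> F" for i S
      proof (rule LIMSEQ_le_const2)
        show "(\<lambda>j. \<Sum>n\<in>S. norm (\<sigma> i n - \<sigma> j n)) \<longlonglongrightarrow> (\<Sum>n\<in>S. norm (\<sigma> i n - x n))"
          by (intro tendsto_intros x)
        have "(\<Sum>n\<in>S. norm (\<sigma> i n - \<sigma> j n)) \<le> \<epsilon>" if "j \<ge> N" for j
          using le_less_trans[OF sum_le_comb_norm[OF comb_vecs_diff[OF mem[of i] mem[of j]] S]]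
            N i that by (simp add: less_imp_le)
        then show "\<exists>N. \<forall>j\<ge>N. (\<Sum>n\<in>S. norm (\<sigma> i n - \<sigma> j n)) \<le> \<epsilon>" by blast
      qed
      then show ?thesis by blast
    qed
    have "(\<lambda>i. \<sigma> i 0) \<longlonglongrightarrow> 0" using comb_vecs_0_index[OF mem] by simp
    then have "x 0 = 0" using x LIMSEQ_unique by blast
    moreover have "\<exists>N. \<forall>S\<in>F. (\<Sum>n\<in>S \<inter> {N..}. norm (x n)) \<le> \<epsilon>" if "\<epsilon> > 0" for \<epsilon>
    proof -
      obtain i where i: "\<And>S. S \<in> F \<Longrightarrow> (\<Sum>n\<in>S. norm (\<sigma> i n - x n)) \<le> \<epsilon>/2"
        using close[OF half_gt_zero[OF \<open>\<epsilon> > 0\<close>]] by blast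
      obtain N where N: "\<And>S. S \<in> F \<Longrightarrow> (\<Sum>n\<in>S \<inter> {N..}. norm (\<sigma> i n)) \<le> \<epsilon>/2"
        using comb_vecsD[OF mem half_gt_zero[OF \<open>\<epsilon> > 0\<close>]] by blast
      have "(\<Sum>n\<in>S \<inter> {N..}. norm (x n)) \<le> \<epsilon>" if S: "S \<in> F" for S
      proof -
        have "(\<Sum>n\<in>S \<inter> {N..}. norm (x n)) \<le>
            (\<Sum>n\<in>S \<inter> {N..}. norm (\<sigma> i n) + norm (\<sigma> i n - x n))"
          by (rule sum_mono) (metis norm_minus_commute norm_triangle_sub)
        also have "\<dots> = (\<Sum>n\<in>S \<inter> {N..}. norm (\<sigma> i n)) + (\<Sum>n\<in>S \<inter> {N..}. norm (\<sigma> i n - x n))"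
          by (rule sum.distrib)
        also have "(\<Sum>n\<in>S \<inter> {N..}. norm (\<sigma> i n - x n)) \<le> (\<Sum>n\<in>S. norm (\<sigma> i n - x n))"
          using finite_members[OF S] by (intro sum_mono2) auto
        finally show ?thesis using i[OF S] N[OF S] by simp
      qed
      then show ?thesis by blast
    qed
    ultimately have x_mem: "x \<in> comb_vecs F" by (simp add: comb_vecs_def)
    have "\<exists>N. \<forall>i\<ge>N. nrm_dist (comb_space F) (\<sigma> i) x < \<epsilon>" if "\<epsilon> > 0" for \<epsilon>
    proof -
      obtain N where N: "\<And>i S. i \<ge> N \<Longrightarrow> S \<in> F \<Longrightarrow> (\<Sum>n\<in>S. norm (\<sigma> i n - x n)) \<le> \<epsilon>/2"
        using close[OF half_gt_zero[OF \<open>\<epsilon> > 0\<close>]] by blast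
      have "comb_norm F (\<sigma> i - x) \<le> \<epsilon>/2" if "i \<ge> N" for i
        by (rule comb_norm_le) (use N[OF that] in simp)
      then show ?thesis using that by (force simp: nrm_dist_comb_space mem x_mem)
    qed
    then show "\<exists>x. limitin metric.mtopology \<sigma> x sequentially"
      using mem x_mem by (auto simp: metric.limit_metric_sequentially)
  qed
qed

lemma in_norm_closureI:
  assumes "x \<in> comb_vecs F"
    and "\<And>\<epsilon>. \<epsilon> > 0 \<Longrightarrow> \<exists>y\<in>A. y \<in> comb_vecs F \<and> comb_norm F (x - y) < \<epsilon>"
  shows "x \<in> norm_topology (comb_space F) closure_of A"
proof -
  interpret metric: Metric_space "comb_vecs F :: (nat \<Rightarrow> 'a) set" "nrm_dist (comb_space F)"
    by (rule metric)
  show ?thesis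
    using assms by (simp add: metric.metric_closure_of metric.in_mball) (metis nrm_dist_comb_space)
qed

lemma trunc_in_span:
  fixes a :: "nat \<Rightarrow> 'f::real_normed_field"
  assumes "finite A" "A \<subseteq> {1..}"
  shows "trunc A a \<in> module.span (scal (comb_space F)) (unit_vec ` {1..})"
proof -
  interpret vector_space "\<lambda>(c::'f) (x::nat \<Rightarrow> 'f) n. c * x n" by (rule vector_space_pointwise)
  have "(\<Sum>n\<in>A. (\<lambda>m. a n * unit_vec n m)) \<in> span (unit_vec ` {1..})"
    using assms(2) by (intro span_sum span_scale span_base) auto
  then show ?thesis by (simp add: sum_unit_vec[OF assms(1)])
qed

lemma span_unit_vec_dense:
  "norm_topology (comb_space F) closure_of
     module.span (scal (comb_space F)) (unit_vec ` {1..} :: (nat \<Rightarrow> 'f::real_normed_field) set) = comb_vecs F"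
    (is "_ closure_of ?S = _")
proof
  interpret metric: Metric_space "comb_vecs F :: (nat \<Rightarrow> 'f) set" "nrm_dist (comb_space F)"
    by (rule metric)
  show "norm_topology (comb_space F) closure_of ?S \<subseteq> comb_vecs F"
    using closure_of_subset_topspace[of metric.mtopology ?S] by simp
  show "comb_vecs F \<subseteq> norm_topology (comb_space F) closure_of ?S"
  proof (rule subsetI, rule in_norm_closureI)
    fix x :: "nat \<Rightarrow> 'f" and \<epsilon> :: real assume x: "x \<in> comb_vecs F" and "\<epsilon> > 0"
    then obtain N where "comb_norm F (x - trunc {1..N} x) \<le> \<epsilon>/2"
      using comb_vecs_tail[OF x half_gt_zero] by blast
    then show "\<exists>y\<in>?S. y \<in> comb_vecs F \<and> comb_norm F (x - y) < \<epsilon>"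
      using \<open>\<epsilon> > 0\<close> trunc_in_span[of "{1..N}" x] trunc_in_comb_vecs_finite[of "{1..N}" x] by force
  qed
qed

lemma comb_norm_le_sum:
  fixes x :: "nat \<Rightarrow> 'f::real_normed_field"
  assumes "finite A"
  shows "comb_norm F (trunc A x) \<le> (\<Sum>n\<in>A. norm (x n))"
proof (rule comb_norm_le)
  fix S assume S: "S \<in> F"
  have "(\<Sum>n\<in>S. norm (trunc A x n)) = (\<Sum>n\<in>S \<inter> A. norm (x n))"
    using finite_members[OF S] by (intro sum.mono_neutral_cong_right) (auto simp: trunc_def)
  also have "\<dots> \<le> (\<Sum>n\<in>A. norm (x n))" using assms by (intro sum_mono2) auto
  finally show "(\<Sum>n\<in>S. norm (trunc A x n)) \<le> (\<Sum>n\<in>A. norm (x n))" .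
qed

text \<open>
  The countable dense set consists of the finitely supported sequences with values in a countable
  dense set of scalars, coded by lists; the entry 0 of a list is skipped.
\<close>

lemma separable_comb_space:
  "separable_space (norm_topology
     (comb_space F :: ('f::{real_normed_field,second_countable_topology}, nat \<Rightarrow> 'f) normed_structure))"
proof -
  interpret metric: Metric_space "comb_vecs F :: (nat \<Rightarrow> 'f) set" "nrm_dist (comb_space F)"
    by (rule metric)
  obtain D :: "'f set" where D: "countable D" "\<And>U. open U \<Longrightarrow> U \<noteq> {} \<Longrightarrow> \<exists>d\<in>D. d \<in> U"
    by (rule countable_dense_setE) blast
  define C where "C = (\<lambda>l. trunc {1..<length l} (\<lambda>n. l ! n)) ` lists D"
  have C_mem: "C \<subseteq> comb_vecs F"
    unfolding C_def by (auto intro!: trunc_in_comb_vecs_finite)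
  have "x \<in> norm_topology (comb_space F) closure_of C" if x: "x \<in> comb_vecs F" for x
  proof (rule in_norm_closureI[OF x])
    fix \<epsilon> :: real assume "\<epsilon> > 0"
    then obtain N where N: "comb_norm F (x - trunc {1..N} x) \<le> \<epsilon>/2"
      using comb_vecs_tail[OF x half_gt_zero] by blast
    \<comment> \<open>The factor \<open>N + 1\<close> instead of \<open>N\<close> keeps the total error below \<open>\<epsilon>/2\<close>, also for \<open>N = 0\<close>.\<close>
    define \<delta> where "\<delta> = \<epsilon> / (2 * (N + 1))"
    have "\<delta> > 0" using \<open>\<epsilon> > 0\<close> by (simp add: \<delta>_def)
    then have "\<exists>d\<in>D. norm (x n - d) < \<delta>" for n
      using D(2)[of "ball (x n) \<delta>"] by (auto simp: dist_norm)
    then obtain d where d: "\<And>n. d n \<in> D" "\<And>n. norm (x n - d n) < \<delta>" by metis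
    define y where "y = trunc {1..N} d"
    have "y = trunc {1..<length (map d [0..<Suc N])} (\<lambda>n. map d [0..<Suc N] ! n)"
      by (auto simp: y_def trunc_def fun_eq_iff nth_append simp del: upt_Suc)
    then have "y \<in> C" unfolding C_def by (rule image_eqI) (use d(1) in auto)
    moreover have "comb_norm F (x - y) < \<epsilon>"
    proof -
      have trunc_mem: "trunc {1..N} z \<in> comb_vecs F" for z :: "nat \<Rightarrow> 'f"
        by (rule trunc_in_comb_vecs_finite) auto
      have "comb_norm F (trunc {1..N} (x - d)) \<le> (\<Sum>n\<in>{1..N}. norm ((x - d) n))"
        by (rule comb_norm_le_sum) simp
      also have "\<dots> \<le> (\<Sum>n\<in>{1..N}. \<delta>)"
        by (rule sum_mono) (simp add: d(2) less_imp_le)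
      also have "\<dots> < \<epsilon>/2" using \<open>\<epsilon> > 0\<close> by (simp add: \<delta>_def field_simps)
      finally have lt: "comb_norm F (trunc {1..N} (x - d)) < \<epsilon>/2" .
      have "x - y = (x - trunc {1..N} x) + trunc {1..N} (x - d)"
        by (auto simp: y_def trunc_def fun_eq_iff)
      then have "comb_norm F (x - y) \<le> comb_norm F (x - trunc {1..N} x) + comb_norm F (trunc {1..N} (x - d))"
        using comb_norm_add[OF comb_vecs_diff[OF x trunc_mem] trunc_mem] by metis
      then show ?thesis using N lt by simp
    qed
    ultimately show "\<exists>y\<in>C. y \<in> comb_vecs F \<and> comb_norm F (x - y) < \<epsilon>" using C_mem by blast
  qed
  then have "metric.mtopology closure_of C = topspace metric.mtopology"
    using closure_of_subset_topspace[of metric.mtopology C] by auto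
  moreover have "countable C" unfolding C_def using D(1) by simp
  ultimately show ?thesis unfolding separable_space_def using C_mem by auto
qed

text \<open>
  A unit vector is not in the span of the others, because all of those vanish at its index.
\<close>

lemma infinite_dimensional_comb_space:
  "infinite_dimensional (comb_space F :: ('f::real_normed_field, nat \<Rightarrow> 'f) normed_structure)"
  unfolding infinite_dimensional_def comb_space_simps
proof
  interpret vector_space "\<lambda>(c::'f) (x::nat \<Rightarrow> 'f) n. c * x n" by (rule vector_space_pointwise)
  assume "\<exists>S. finite S \<and> S \<subseteq> comb_vecs F \<and> span S = comb_vecs F"
  then obtain S :: "(nat \<Rightarrow> 'f) set" where S: "finite S" "span S = comb_vecs F" by blast
  have "independent (unit_vec ` {1..} :: (nat \<Rightarrow> 'f) set)"
  proof
    assume "dependent (unit_vec ` {1..} :: (nat \<Rightarrow> 'f) set)"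
    then obtain n where "(unit_vec n :: nat \<Rightarrow> 'f) \<in> span (unit_vec ` {1..} - {unit_vec n})"
      unfolding dependent_def by blast
    moreover have "span (unit_vec ` {1..} - {unit_vec n}) \<subseteq> {x :: nat \<Rightarrow> 'f. x n = 0}"
      by (rule span_minimal) (auto simp: unit_vec_def intro: subspaceI)
    ultimately show False by (auto simp: unit_vec_def)
  qed
  then have "finite (unit_vec ` {1..} :: (nat \<Rightarrow> 'f) set)"
    using independent_span_bound[OF S(1)] S(2) unit_vec_in_comb_vecs by blast
  then show False
    using finite_imageD[OF _ inj_on_subset[OF inj_unit_vec subset_UNIV]] infinite_Ici by blast
qed

lemma banach_space_comb_space:
  "banach_space (comb_space F ::
     ('f::{real_normed_field,banach,second_countable_topology}, nat \<Rightarrow> 'f) normed_structure)"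
  using normed_space_comb_space mcomplete_comb_space separable_comb_space infinite_dimensional_comb_space
  by (simp add: banach_space_def)

section \<open>The unit vector basis\<close>

lemma proj_comb_space:
  assumes "finite A" "x \<in> comb_vecs F"
  shows "proj (comb_space F) unit_vec (coord F) A x = trunc A x"
  unfolding proj_def sum_scal_unit_vec[OF assms(1)]
  using assms(2) by (simp add: trunc_def coord_def)

lemma coord_in_dual: "coord F n \<in> dual (comb_space F)"
  unfolding dual_def
  by (auto simp: coord_def comb_vecs_add comb_vecs_scale intro!: exI[of _ 1] coord_le_comb_norm)

lemma dual_norm_coord:
  assumes "n \<ge> 1"
  shows "dual_norm (comb_space F) (coord F n :: (nat \<Rightarrow> 'f::real_normed_field) \<Rightarrow> 'f) = 1"
proof -
  let ?B = "{x :: nat \<Rightarrow> 'f. x \<in> comb_vecs F \<and> comb_norm F x \<le> 1}"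
  have le: "norm (coord F n x) \<le> 1" if "x \<in> ?B" for x
    using that coord_le_comb_norm[of x n] by (simp add: coord_def)
  have mem: "unit_vec n \<in> ?B"
    using assms by (simp add: unit_vec_in_comb_vecs comb_norm_unit_vec)
  have "(SUP x\<in>?B. norm (coord F n x)) \<le> 1"
    using mem le by (intro cSUP_least) auto
  moreover have "norm (coord F n (unit_vec n) :: 'f) \<le> (SUP x\<in>?B. norm (coord F n x))"
    using mem le by (intro cSUP_upper) (auto simp: bdd_above_def)
  ultimately show ?thesis
    using mem by (simp add: dual_norm_def coord_def unit_vec_def)
qed

lemma basis_comb_space:
  "basis (comb_space F :: ('f::real_normed_field, nat \<Rightarrow> 'f) normed_structure) unit_vec (coord F)"
proof -
  have "(\<lambda>n. comb_norm F (unit_vec n :: nat \<Rightarrow> 'f)) ` {1..} = {1}"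
    by (auto simp: comb_norm_unit_vec image_iff)
  moreover have "(\<lambda>n. dual_norm (comb_space F) (coord F n :: (nat \<Rightarrow> 'f) \<Rightarrow> 'f)) ` {1..} = {1}"
    by (auto simp: dual_norm_coord image_iff)
  ultimately show ?thesis
    using span_unit_vec_dense[where ?'f='f]
    by (simp add: basis_def coord_in_dual unit_vec_in_comb_vecs) (simp add: coord_def unit_vec_def unit_vec_in_comb_vecs)
qed

lemma dual_bounded: "f \<in> dual (comb_space F) \<Longrightarrow> \<exists>K. \<forall>x\<in>comb_vecs F. norm (f x) \<le> K * comb_norm F x"
  by (simp add: dual_def)

lemma bounded_trunc_tendsto:
  fixes f :: "(nat \<Rightarrow> 'f::real_normed_field) \<Rightarrow> 'f"
  assumes "f \<in> dual (comb_space F)" and x: "x \<in> comb_vecs F"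
  shows "(\<lambda>m. f (trunc {1..m} x)) \<longlonglongrightarrow> f x"
proof (rule LIMSEQ_I)
  fix \<epsilon> :: real assume "\<epsilon> > 0"
  have add: "\<And>x y. x \<in> comb_vecs F \<Longrightarrow> y \<in> comb_vecs F \<Longrightarrow> f (x + y) = f x + f y"
    using assms(1) by (simp add: dual_def)
  obtain K where K: "\<And>x. x \<in> comb_vecs F \<Longrightarrow> norm (f x) \<le> K * comb_norm F x"
    using dual_bounded[OF assms(1)] by blast
  have "\<epsilon> / (2 * (\<bar>K\<bar> + 1)) > 0" using \<open>\<epsilon> > 0\<close> by (simp add: add_nonneg_pos)
  then obtain N where N: "\<forall>m\<ge>N. comb_norm F (x - trunc {1..m} x) \<le> \<epsilon> / (2 * (\<bar>K\<bar> + 1))"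
    using comb_vecs_tail[OF x] by blast
  have "norm (f (trunc {1..m} x) - f x) < \<epsilon>" if "m \<ge> N" for m
  proof -
    have mem: "trunc {1..m} x \<in> comb_vecs F" by (rule trunc_in_comb_vecs_finite) auto
    let ?y = "x - trunc {1..m} x"
    have y: "?y \<in> comb_vecs F" by (rule comb_vecs_diff[OF x mem])
    have "f x = f ?y + f (trunc {1..m} x)" using add[OF y mem] by simp
    then have "norm (f (trunc {1..m} x) - f x) = norm (f ?y)" by (simp add: norm_minus_commute)
    also have "\<dots> \<le> K * comb_norm F ?y" by (rule K[OF y])
    also have "\<dots> \<le> (\<bar>K\<bar> + 1) * (\<epsilon> / (2 * (\<bar>K\<bar> + 1)))"
      using N that comb_norm_nonneg[OF y] by (intro mult_mono) auto
    also have "\<dots> = \<epsilon> / 2" by (simp add: divide_simps)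
    finally show ?thesis using \<open>\<epsilon> > 0\<close> by simp
  qed
  then show "\<exists>N. \<forall>m\<ge>N. norm (f (trunc {1..m} x) - f x) < \<epsilon>" by blast
qed

lemma dual_trunc_eq_sum:
  fixes f :: "(nat \<Rightarrow> 'f::real_normed_field) \<Rightarrow> 'f"
  assumes "f \<in> dual (comb_space F)" "finite A" "A \<subseteq> {1..}" 
  shows "f (trunc A x) = (\<Sum>n\<in>A. x n * f (unit_vec n))"
  using assms(2,3)
proof (induction A rule: finite_induct)
  case empty
  have "f (\<lambda>n. 0 * 0 n) = 0 * f 0" using assms(1) comb_vecs_0 unfolding dual_def by fastforce
  then show ?case by (simp add: trunc_def)
next
  case (insert k A)
  have k: "(\<lambda>n. x k * unit_vec k n) \<in> comb_vecs F"
    using insert.prems by (intro comb_vecs_scale unit_vec_in_comb_vecs) simp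
  have A: "trunc A x \<in> comb_vecs F"
    using insert by (intro trunc_in_comb_vecs_finite) auto
  have "trunc (insert k A) x = (\<lambda>n. x k * unit_vec k n) + trunc A x"
    using insert.hyps by (auto simp: trunc_def unit_vec_def fun_eq_iff)
  then have "f (trunc (insert k A) x) = f (\<lambda>n. x k * unit_vec k n) + f (trunc A x)"
    using assms(1) k A by (simp add: dual_def)
  also have "f (\<lambda>n. x k * unit_vec k n) = x k * f (unit_vec k)"
    using assms(1) insert.prems by (simp add: dual_def unit_vec_in_comb_vecs)
  finally show ?case using insert by simp
qed

text \<open>
  A functional \<open>f\<close> is the weak* limit of its compositions with the partial sum projections, since the
  partial sums of \<open>x\<close> converge to \<open>x\<close> in norm; and those compositions are the linear combinations
  \<open>\<Sum>n\<le>m. f (e\<^sub>n) e\<^sub>n\<^sup>*\<close> of the coordinate functionals.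
\<close>

lemma span_coord_weak_star_dense:
  "weak_star (comb_space F) closure_of
     module.span (\<lambda>c f x. c * f x) (coord F ` {1..} :: ((nat \<Rightarrow> 'f::real_normed_field) \<Rightarrow> 'f) set)
   = dual (comb_space F)"
    (is "?W closure_of ?S = ?D")
proof
  interpret vector_space "\<lambda>(c::'f) (f::(nat \<Rightarrow> 'f) \<Rightarrow> 'f) x. c * f x" by (rule vector_space_pointwise)
  have top: "topspace ?W = ?D" by (rule topspace_weak_star[OF normed_space_comb_space])
  show "?W closure_of ?S \<subseteq> ?D" using closure_of_subset_topspace[of ?W ?S] top by simp
  show "?D \<subseteq> ?W closure_of ?S"
  proof
    fix f assume f: "f \<in> ?D"
    define g where "g m = (\<Sum>n\<in>{1..m}. (\<lambda>x. f (unit_vec n) * coord F n x))" for m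
    have g_span: "g m \<in> ?S" for m
      unfolding g_def by (intro span_sum span_scale span_base) auto
    have g_eq: "g m x = f (trunc {1..m} x)" if "x \<in> comb_vecs F" for m x
      using dual_trunc_eq_sum[OF f, of "{1..m}" x] that
      by (simp add: g_def sum_fun_apply coord_def mult.commute)
    have "?S \<subseteq> ?D"
    proof (rule span_minimal)
      show "coord F ` {1..} \<subseteq> ?D" using coord_in_dual by blast
      show "subspace ?D"
      proof (rule subspaceI)
        show "0 \<in> ?D" by (auto simp: dual_def comb_norm_nonneg intro!: exI[of _ 1])
      next
        fix u v assume u: "u \<in> ?D" and v: "v \<in> ?D"
        obtain K L where "\<And>x. x \<in> comb_vecs F \<Longrightarrow> norm (u x) \<le> K * comb_norm F x"
          and "\<And>x. x \<in> comb_vecs F \<Longrightarrow> norm (v x) \<le> L * comb_norm F x"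
          using dual_bounded[OF u] dual_bounded[OF v] by blast
        then have "\<exists>M. \<forall>x\<in>comb_vecs F. norm (u x + v x) \<le> M * comb_norm F x"
          by (intro exI[of _ "K + L"]) (auto simp: distrib_right intro!: norm_triangle_le add_mono)
        then show "u + v \<in> ?D" using u v by (simp add: dual_def distrib_left)
      next
        fix c u assume u: "u \<in> ?D"
        obtain K where "\<And>x. x \<in> comb_vecs F \<Longrightarrow> norm (u x) \<le> K * comb_norm F x"
          using dual_bounded[OF u] by blast
        then have "\<exists>M. \<forall>x\<in>comb_vecs F. norm (c * u x) \<le> M * comb_norm F x"
          by (intro exI[of _ "norm c * K"]) (auto simp: norm_mult mult.assoc intro!: mult_left_mono)
        then show "(\<lambda>x. c * u x) \<in> ?D" using u by (simp add: dual_def distrib_left mult.left_commute)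
      qed
    qed
    then have g_dual: "g m \<in> ?D" for m using g_span by blast
    have "\<exists>h\<in>?S. h \<in> U" if U: "openin ?W U" "f \<in> U" for U
    proof -
      have "eventually (\<lambda>m. g m \<in> U) sequentially"
      proof (rule eventually_in_generated_open)
        show "generate_topology_on {{f \<in> ?D. f x \<in> V} | x V. x \<in> vecs (comb_space F) \<and> open V} U"
          using U(1) unfolding weak_star_def by (rule openin_topology_generated_by)
      next
        fix B assume "B \<in> {{f \<in> ?D. f x \<in> V} | x V. x \<in> vecs (comb_space F) \<and> open V}" "f \<in> B"
        then obtain x V where B: "B = {f \<in> ?D. f x \<in> V}" and x: "x \<in> comb_vecs F" and V: "open V" "f x \<in> V"
          by auto
        have "eventually (\<lambda>m. f (trunc {1..m} x) \<in> V) sequentially"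
          using bounded_trunc_tendsto[OF f x] V by (rule topological_tendstoD)
        then show "eventually (\<lambda>m. g m \<in> B) sequentially"
          by (simp add: B g_dual g_eq[OF x])
      qed (fact U(2))
      then obtain m where "g m \<in> U" using eventually_happens'[OF sequentially_bot] by blast
      then show ?thesis using g_span by blast
    qed
    then show "f \<in> ?W closure_of ?S" using f by (auto simp: in_closure_of top)
  qed
qed

lemma schauder_basis_comb_space:
  "schauder_basis (comb_space F :: ('f::real_normed_field, nat \<Rightarrow> 'f) normed_structure) unit_vec (coord F)"
proof -
  have "nrm (comb_space F) (\<Sum>n=1..m. scal (comb_space F) (coord F n x) (unit_vec n))
      \<le> 1 * nrm (comb_space F) x" if "x \<in> comb_vecs F" for x :: "nat \<Rightarrow> 'f" and m
    unfolding sum_scal_unit_vec[OF finite_atLeastAtMost]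
    using that by (auto simp: trunc_def coord_def intro!: comb_norm_mono)
  then show ?thesis
    unfolding schauder_basis_def comb_space_simps(2)
    using basis_comb_space span_coord_weak_star_dense by blast
qed

lemma one_unconditional_comb_space:
  "one_unconditional (comb_space F :: ('f::real_normed_field, nat \<Rightarrow> 'f) normed_structure) unit_vec"
  unfolding one_unconditional_def sum_scal_unit_vec[OF finite_atLeastAtMost]
  unfolding comb_space_simps
proof (intro allI impI)
  fix N :: nat and a b :: "nat \<Rightarrow> 'f"
  assume "\<forall>n\<in>{1..N}. norm (a n) \<le> norm (b n)"
  then show "comb_norm F (trunc {1..N} a) \<le> comb_norm F (trunc {1..N} b)"
    by (intro comb_norm_mono trunc_in_comb_vecs_finite) (auto simp: trunc_def)
qed

section \<open>A set weight from the norms of indicators\<close>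

text \<open>
  Real scalars suffice here: the norm of an indicator is the same over every field.
\<close>

definition indicator_norm :: "nat set \<Rightarrow> real" where
  "indicator_norm A = comb_norm F (trunc A (\<lambda>_. 1 :: real))"

lemma comb_norm_const_le:
  fixes x :: "nat \<Rightarrow> 'f::real_normed_field"
  assumes "finite A" "A \<subseteq> {1..}" "0 \<le> t" "\<And>n. n \<in> A \<Longrightarrow> norm (x n) \<le> t"
  shows "comb_norm F (trunc A x) \<le> t * indicator_norm A"
proof -
  let ?u = "trunc A (\<lambda>_. 1 :: real)"
  have u: "?u \<in> comb_vecs F" using assms by (intro trunc_in_comb_vecs_finite) auto
  have "comb_norm F (trunc A x) \<le> comb_norm F (\<lambda>n. t * ?u n)"
  proof (rule comb_norm_le)
    fix S assume "S \<in> F"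
    have "(\<Sum>n\<in>S. norm (trunc A x n)) \<le> (\<Sum>n\<in>S. norm (t * ?u n))"
      using assms by (intro sum_mono) (simp add: trunc_def)
    also have "\<dots> \<le> comb_norm F (\<lambda>n. t * ?u n)"
      using \<open>S \<in> F\<close> by (rule sum_le_comb_norm[OF comb_vecs_scale[OF u]])
    finally show "(\<Sum>n\<in>S. norm (trunc A x n)) \<le> comb_norm F (\<lambda>n. t * ?u n)" .
  qed
  then show ?thesis using comb_norm_scale[OF u, of t] assms by (simp add: indicator_norm_def)
qed

lemma const_le_comb_norm:
  fixes x :: "nat \<Rightarrow> 'f::real_normed_field"
  assumes "x \<in> comb_vecs F" "finite A" "A \<subseteq> {1..}" "0 \<le> t" "\<And>n. n \<in> A \<Longrightarrow> t \<le> norm (x n)"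
  shows "t * indicator_norm A \<le> comb_norm F x"
proof -
  let ?u = "trunc A (\<lambda>_. 1 :: real)"
  have u: "?u \<in> comb_vecs F" using assms by (intro trunc_in_comb_vecs_finite) auto
  have "comb_norm F (\<lambda>n. t * ?u n) \<le> comb_norm F x"
  proof (rule comb_norm_le)
    fix S assume "S \<in> F"
    have "(\<Sum>n\<in>S. norm (t * ?u n)) \<le> (\<Sum>n\<in>S. norm (x n))"
      using assms by (intro sum_mono) (simp add: trunc_def)
    also have "\<dots> \<le> comb_norm F x"
      using \<open>S \<in> F\<close> by (rule sum_le_comb_norm[OF assms(1)])
    finally show "(\<Sum>n\<in>S. norm (t * ?u n)) \<le> comb_norm F x" .
  qed
  then show ?thesis using comb_norm_scale[OF u, of t] assms by (simp add: indicator_norm_def)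
qed

lemma indicator_norm_nonneg: "finite A \<Longrightarrow> A \<subseteq> {1..} \<Longrightarrow> 0 \<le> indicator_norm A"
  unfolding indicator_norm_def by (intro comb_norm_nonneg trunc_in_comb_vecs_finite)

lemma indicator_norm_ge_1:
  assumes "finite A" "A \<subseteq> {1..}" "A \<noteq> {}"
  shows "1 \<le> indicator_norm A"
proof -
  obtain n where "n \<in> A" using assms by blast
  then show ?thesis
    using coord_le_comb_norm[OF trunc_in_comb_vecs_finite[OF assms(1,2)], of "\<lambda>_. 1::real" n]
    by (simp add: indicator_norm_def trunc_def)
qed

lemma indicator_norm_empty: "indicator_norm {} = 0"
  using nonempty by (simp add: indicator_norm_def trunc_def comb_norm_def)

definition indicator_weight :: "nat set \<Rightarrow> ennreal" where
  "indicator_weight A = (if finite A then ennreal (indicator_norm A) else top)"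

lemma set_weight_indicator_weight: "set_weight indicator_weight"
  using indicator_norm_ge_1 by (fastforce simp: set_weight_def indicator_weight_def indicator_norm_empty)

text \<open>
  Writing \<open>t\<close> for the least modulus on the greedy set \<open>A\<close>, the part of \<open>x\<close> on \<open>B - A\<close> has norm at most
  \<open>t \<parallel>1\<^bsub>B - A\<^esub>\<parallel> \<le> t \<parallel>1\<^bsub>A - B\<^esub>\<parallel> \<le> \<parallel>x - P\<^sub>B x\<parallel>\<close>, and the part off \<open>A \<union> B\<close> is dominated by \<open>x - P\<^sub>B x\<close>.
  Each contributes 1 to the constant 2.
\<close>

lemma strong_partially_greedy_indicator_weight:
  assumes nn: "\<forall>k\<ge>1. 1 \<le> nn k"
  shows "strong_partially_greedy
    (comb_space F :: ('f::real_normed_field, nat \<Rightarrow> 'f) normed_structure) unit_vec (coord F) nn indicator_weight"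
  unfolding strong_partially_greedy_def
proof (intro exI[of _ 2] conjI ballI allI impI)
  fix x :: "nat \<Rightarrow> 'f" and m A
  assume "x \<in> vecs (comb_space F)" "m \<ge> 1" and greedy: "greedy_set (coord F) x m A"
  then have x: "x \<in> comb_vecs F" and A: "finite A" "A \<subseteq> {1..}" "A \<noteq> {}"
    and dom: "\<And>i j. i \<in> A \<Longrightarrow> j \<ge> 1 \<Longrightarrow> j \<notin> A \<Longrightarrow> norm (x j) \<le> norm (x i)"
    by (auto simp: greedy_set_def coord_def)
  let ?B = "initial_set nn"
  have B: "finite (?B k)" "?B k \<subseteq> {1..}" for k
    using nn by (auto simp: initial_set_def)
  note proj = proj_comb_space[OF A(1) x] proj_comb_space[OF B(1) x]
  have trunc_mem: "trunc (?B k) x \<in> comb_vecs F" for k using B by (rule trunc_in_comb_vecs_finite)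
  define t where "t = Min ((\<lambda>n. norm (x n)) ` A)"
  have t_le: "t \<le> norm (x n)" if "n \<in> A" for n
    unfolding t_def using A that by (intro Min_le) auto
  obtain i where i: "i \<in> A" "t = norm (x i)"
    using Min_in[of "(\<lambda>n. norm (x n)) ` A"] A unfolding t_def image_iff by blast
  have key: "comb_norm F (x - trunc A x) \<le> 2 * comb_norm F (x - trunc (?B k) x)"
    if le: "indicator_weight (?B k - A) \<le> indicator_weight (A - ?B k)" for k
  proof -
    let ?D = "?B k - A" and ?E = "A - ?B k"
    let ?y = "x - trunc (?B k) x"
    have y: "?y \<in> comb_vecs F" using x trunc_mem by (rule comb_vecs_diff)
    let ?z = "trunc (- (A \<union> ?B k)) x"
    have z: "?z \<in> comb_vecs F" by (rule comb_vecs_dominated[OF x]) (simp add: trunc_def)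
    have D: "finite ?D" "?D \<subseteq> {1..}" and E: "finite ?E" "?E \<subseteq> {1..}" using A B[of k] by auto
    have "comb_norm F (trunc ?D x) \<le> t * indicator_norm ?D"
      using D dom i by (intro comb_norm_const_le) auto
    also have "\<dots> \<le> t * indicator_norm ?E"
      using le D E indicator_norm_nonneg[OF E] i(2) by (intro mult_left_mono) (auto simp: indicator_weight_def)
    also have "\<dots> \<le> comb_norm F ?y"
      using E y t_le i(2) by (intro const_le_comb_norm) (auto simp: trunc_def)
    finally have "comb_norm F (trunc ?D x) \<le> comb_norm F ?y" .
    moreover have "comb_norm F ?z \<le> comb_norm F ?y"
      by (rule comb_norm_mono[OF y]) (auto simp: trunc_def)
    moreover have "x - trunc A x = trunc ?D x + ?z"
      by (auto simp: trunc_def fun_eq_iff)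
    ultimately show ?thesis
      using comb_norm_add[OF trunc_in_comb_vecs_finite[OF D] z, of x] by simp
  qed
  let ?V = "{comb_norm F (x - trunc (?B k) x) | k. indicator_weight (?B k - A) \<le> indicator_weight (A - ?B k)}"
  have "comb_norm F (x - trunc A x) / 2 \<le> Inf ?V"
  proof (rule cInf_greatest)
    \<comment> \<open>The empty initial set is always admissible, so the infimum is not over the empty set.\<close>
    have "comb_norm F (x - trunc (?B 0) x) \<in> ?V"
      by (auto simp: initial_set_def indicator_weight_def indicator_norm_empty intro!: exI[of _ 0])
    then show "?V \<noteq> {}" by blast
  qed (use key in force)
  then show "nrm (comb_space F) (x - proj (comb_space F) unit_vec (coord F) A x)
      \<le> 2 * sigma_hat (comb_space F) unit_vec (coord F) nn indicator_weight A x"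
    by (simp add: sigma_hat_def proj)
qed simp

section \<open>Failure for all weight sequences\<close>

text \<open>
  All nonzero coordinates of \<open>x = 1\<^bsub>B \<union> E\<^esub>\<close> have modulus 1, so \<open>A = E \<union> (B - D)\<close> is a greedy set of \<open>x\<close>.
  It is chosen so that \<open>B - A = D\<close> and \<open>A - B = E\<close>.
\<close>

lemma strong_partially_greedyD:
  assumes nn: "\<forall>k\<ge>1. 1 \<le> nn k"
    and "strong_partially_greedy
      (comb_space F :: ('f::real_normed_field, nat \<Rightarrow> 'f) normed_structure) unit_vec (coord F) nn \<omega>"
  shows "\<exists>C. \<forall>k D E. D \<subseteq> initial_set nn k \<longrightarrow> finite E \<longrightarrow> E \<subseteq> {1..} \<longrightarrow> E \<noteq> {} \<longrightarrow>
    E \<inter> initial_set nn k = {} \<longrightarrow> \<omega> D \<le> \<omega> E \<longrightarrow> indicator_norm D \<le> C * indicator_norm E"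
proof -
  obtain C where C: "C \<ge> 1"
    "\<And>x m A. x \<in> comb_vecs F \<Longrightarrow> m \<ge> 1 \<Longrightarrow> greedy_set (coord F) x m A \<Longrightarrow>
       comb_norm F (x - proj (comb_space F) unit_vec (coord F) A x)
        \<le> C * sigma_hat (comb_space F) unit_vec (coord F) nn \<omega> A (x :: nat \<Rightarrow> 'f)"
    using assms(2) unfolding strong_partially_greedy_def comb_space_simps by blast
  have norm_ind: "comb_norm F (trunc A (\<lambda>_. 1 :: 'f)) = indicator_norm A" for A
    unfolding indicator_norm_def comb_norm_def trunc_def by (simp add: if_distrib cong: if_cong)
  have "indicator_norm D \<le> C * indicator_norm E"
    if D: "D \<subseteq> initial_set nn k" and E: "finite E" "E \<subseteq> {1..}" "E \<noteq> {}"
      and disj: "E \<inter> initial_set nn k = {}" and le: "\<omega> D \<le> \<omega> E" for k D E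
  proof -
    let ?B = "initial_set nn"
    have B: "finite (?B k)" "?B k \<subseteq> {1..}" for k
      using nn by (auto simp: initial_set_def)
    define x where "x = trunc (?B k \<union> E) (\<lambda>_. 1 :: 'f)"
    define A where "A = E \<union> (?B k - D)"
    have x: "x \<in> comb_vecs F"
      unfolding x_def using B E by (intro trunc_in_comb_vecs_finite) auto
    have A: "finite A" "A \<subseteq> {1..}" "A \<noteq> {}" using B[of k] E by (auto simp: A_def)
    have "norm (x j) \<le> norm (x i)" if "i \<in> A" for i j
      using that by (auto simp: x_def trunc_def A_def)
    then have "greedy_set (coord F) x (card A) A"
      using A x by (auto simp: greedy_set_def coord_def)
    moreover have "card A \<ge> 1" using A by (simp add: Suc_le_eq card_gt_0_iff)
    ultimately have le1: "comb_norm F (x - trunc A x)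
        \<le> C * sigma_hat (comb_space F) unit_vec (coord F) nn \<omega> A x"
      using C(2)[OF x] proj_comb_space[OF A(1) x] by metis
    let ?V = "{comb_norm F (x - trunc (?B k) x) | k. \<omega> (?B k - A) \<le> \<omega> (A - ?B k)}"
    have "?B k - A = D" "A - ?B k = E" using D disj by (auto simp: A_def)
    then have "comb_norm F (x - trunc (?B k) x) \<in> ?V" using le by auto
    moreover have "bdd_below ?V"
      using comb_norm_nonneg[OF comb_vecs_diff[OF x trunc_in_comb_vecs_finite[OF B]]]
      by (auto simp: bdd_below_def intro!: exI[of _ 0])
    ultimately have "Inf ?V \<le> comb_norm F (x - trunc (?B k) x)" by (rule cInf_lower)
    moreover have "sigma_hat (comb_space F) unit_vec (coord F) nn \<omega> A x = Inf ?V"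
      by (simp add: sigma_hat_def proj_comb_space[OF B(1) x])
    ultimately have "comb_norm F (x - trunc A x) \<le> C * comb_norm F (x - trunc (?B k) x)"
      using le1 C(1) by (smt (verit) mult_left_mono)
    moreover have "x - trunc A x = trunc D (\<lambda>_. 1)" "x - trunc (?B k) x = trunc E (\<lambda>_. 1)"
      using D disj by (auto simp: x_def A_def trunc_def fun_eq_iff)
    ultimately show ?thesis by (simp add: norm_ind)
  qed
  then show ?thesis by blast
qed

end

text \<open>
  With \<open>r n\<close> read as the row of \<open>n\<close>, the norm of this family is that of \<open>\<ell>\<^sub>1(c\<^sub>0)\<close>.
\<close>

definition transversals :: "(nat \<Rightarrow> nat) \<Rightarrow> nat set set" where
  "transversals r = {S. finite S \<and> S \<subseteq> {1..} \<and> inj_on r S}"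

interpretation transversals: finite_cover "transversals r"
  by unfold_locales (auto simp: transversals_def intro!: exI[of _ "{_}"])

abbreviation transversal_norm :: "(nat \<Rightarrow> nat) \<Rightarrow> nat set \<Rightarrow> real" where
  "transversal_norm r \<equiv> finite_cover.indicator_norm (transversals r)"

lemma transversal_norm_row:
  assumes "\<And>n. n \<in> E \<Longrightarrow> r n = i"
  shows "transversal_norm r E \<le> 1"
  unfolding transversals.indicator_norm_def
proof (rule transversals.comb_norm_le)
  fix S assume "S \<in> transversals r"
  then have S: "finite S" "inj_on r S" by (auto simp: transversals_def)
  have "card (S \<inter> E) = card (r ` (S \<inter> E))"
    using inj_on_subset[OF S(2)] by (intro card_image[symmetric]) auto
  also have "\<dots> \<le> card {i}" using assms by (intro card_mono) auto
  finally have "card (S \<inter> E) \<le> 1" by simp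
  moreover have "(\<Sum>n\<in>S. norm (trunc E (\<lambda>_. 1 :: real) n)) = (\<Sum>n\<in>S \<inter> E. 1)"
    using S by (intro sum.mono_neutral_cong_right) (auto simp: trunc_def)
  ultimately show "(\<Sum>n\<in>S. norm (trunc E (\<lambda>_. 1 :: real) n)) \<le> 1" by simp
qed

lemma card_le_transversal_norm:
  assumes "finite D" "D \<subseteq> {1..}" "inj_on r D"
  shows "real (card D) \<le> transversal_norm r D"
proof -
  have "(\<Sum>n\<in>D. norm (trunc D (\<lambda>_. 1 :: real) n)) \<le> transversal_norm r D"
    unfolding transversals.indicator_norm_def
    using assms by (intro transversals.sum_le_comb_norm transversals.trunc_in_comb_vecs_finite)
      (auto simp: transversals_def)
  then show ?thesis by (simp add: trunc_def)
qed

lemma induced_weight_le_iff: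
  assumes "weight_sequence s" "finite D" "D \<subseteq> {1..}" "finite E" "E \<subseteq> {1..}"
  shows "induced_weight s D \<le> induced_weight s E \<longleftrightarrow> (\<Sum>n\<in>D. s n) \<le> (\<Sum>n\<in>E. s n)"
proof -
  have nonneg: "0 \<le> s n" if "n \<in> D \<union> E" for n
  proof -
    have "n \<ge> 1" using assms(3,5) that by auto
    then show ?thesis using assms(1) by (simp add: weight_sequence_def less_imp_le)
  qed
  then have "(\<Sum>n\<in>D. ennreal (s n)) = ennreal (\<Sum>n\<in>D. s n)"
    and "(\<Sum>n\<in>E. ennreal (s n)) = ennreal (\<Sum>n\<in>E. s n)"
    by (auto intro!: sum_ennreal)
  moreover have "0 \<le> (\<Sum>n\<in>D. s n)" "0 \<le> (\<Sum>n\<in>E. s n)" using nonneg by (auto intro: sum_nonneg)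
  ultimately show ?thesis using assms by (simp add: induced_weight_finite)
qed

text \<open>
  If all terms exceeded \<open>\<delta>\<close>, sums over sufficiently many of them would exceed the bound.
\<close>

lemma exists_term_le_of_bounded_sums:
  fixes u :: "'a \<Rightarrow> real"
  assumes "infinite R" and bound: "\<And>G. finite G \<Longrightarrow> G \<subseteq> R \<Longrightarrow> sum u G \<le> b" and "\<delta> > 0"
  shows "\<exists>k\<in>R. u k \<le> \<delta>"
proof (rule ccontr)
  assume "\<not> ?thesis"
  then have big: "\<And>k. k \<in> R \<Longrightarrow> \<delta> < u k" by force
  obtain N :: nat where N: "b < real N * \<delta>"
    using ex_less_of_nat_mult[OF \<open>\<delta> > 0\<close>] by blast
  obtain G where G: "finite G" "card G = N" "G \<subseteq> R"
    using infinite_arbitrarily_large[OF assms(1)] by blast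
  have "real (card G) * \<delta> \<le> sum u G"
    using G(3) big by (intro sum_bounded_below) (auto intro: less_imp_le)
  then show False using N G bound[of G] by simp
qed

text \<open>
  The property of additive weights that defeats the \<open>\<ell>\<^sub>1(c\<^sub>0)\<close> norm: a set \<open>D\<close> of large norm
  can be outweighed by a set \<open>E\<close> of norm 1 that avoids an initial set around \<open>D\<close>. Either a single row is heavy enough to outweigh anything, or
  every row offers elements so light that \<open>M\<close> of them are outweighed by the one point \<open>p\<close>.
\<close>

lemma exists_light_long_set:
  fixes nn r :: "nat \<Rightarrow> nat" and s :: "nat \<Rightarrow> real" and M :: nat
  assumes inj: "inj_on nn {1..}" and pos: "\<forall>k\<ge>1. 1 \<le> nn k"
    and p: "p \<ge> 1" "p \<notin> nn ` {1..}"
    and rows: "\<And>i. infinite {k \<in> {1..}. r (nn k) = i}"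
    and s: "weight_sequence s" and "M \<ge> 1"
  shows "\<exists>k D E. D \<subseteq> initial_set nn k \<and> finite E \<and> E \<subseteq> {1..} \<and> E \<noteq> {} \<and>
    E \<inter> initial_set nn k = {} \<and> (\<Sum>n\<in>D. s n) \<le> (\<Sum>n\<in>E. s n) \<and>
    real M \<le> transversal_norm r D \<and> transversal_norm r E \<le> 1"
proof -
  let ?R = "\<lambda>i. {k \<in> {1..}. r (nn k) = i}"
  have s_pos: "0 < s n" if "n \<ge> 1" for n using s that by (simp add: weight_sequence_def)
  have choice_set: "\<exists>D k. finite D \<and> D \<subseteq> initial_set nn k \<and> D = (\<lambda>i. nn (\<kappa> i)) ` {..<M} \<and>
      real M \<le> transversal_norm r D"
    if \<kappa>: "\<And>i. \<kappa> i \<in> ?R i" for \<kappa>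
  proof -
    let ?D = "(\<lambda>i. nn (\<kappa> i)) ` {..<M}"
    have row: "r (nn (\<kappa> i)) = i" and ge: "\<kappa> i \<ge> 1" for i using \<kappa>[of i] by auto
    have "inj_on (\<lambda>i. nn (\<kappa> i)) {..<M}" by (rule inj_onI) (metis row)
    then have "card ?D = M" by (simp add: card_image)
    moreover have "real (card ?D) \<le> transversal_norm r ?D"
      using pos ge by (intro card_le_transversal_norm) (auto intro!: inj_onI simp: row)
    moreover have "?D \<subseteq> initial_set nn (Max (\<kappa> ` {..<M}))"
      using ge by (force simp: initial_set_def intro!: imageI Max_ge)
    ultimately show ?thesis by auto
  qed
  show ?thesis
  proof (cases "\<exists>i. \<forall>b. \<exists>G. finite G \<and> G \<subseteq> ?R i \<and> b < (\<Sum>k\<in>G. s (nn k))")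
    case True
    then obtain i where i: "\<And>b. \<exists>G. finite G \<and> G \<subseteq> ?R i \<and> b < (\<Sum>k\<in>G. s (nn k))" by blast
    have "\<exists>k. k \<in> ?R i" for i using infinite_imp_nonempty[OF rows[of i]] by blast
    then obtain \<kappa> where "\<And>i. \<kappa> i \<in> ?R i" by metis
    from choice_set[OF this] obtain D k where D: "finite D" "D \<subseteq> initial_set nn k" "real M \<le> transversal_norm r D"
      by blast
    have D_pos: "D \<subseteq> {1..}" using D(2) pos by (force simp: initial_set_def)
    have w: "0 \<le> (\<Sum>n\<in>D. s n)"
      using s_pos D_pos by (intro sum_nonneg less_imp_le) auto
    \<comment> \<open>The surplus over the weight of \<open>D\<close> pays for removing the first \<open>k\<close> positions from \<open>G\<close>.\<close>
    obtain G where G: "finite G" "G \<subseteq> ?R i" "(\<Sum>n\<in>D. s n) + (\<Sum>k\<in>{1..k}. s (nn k)) < (\<Sum>k\<in>G. s (nn k))"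
      using i by blast
    let ?E = "nn ` (G - {1..k})"
    have "(\<Sum>k\<in>G. s (nn k)) = (\<Sum>k\<in>G \<inter> {1..k}. s (nn k)) + (\<Sum>k\<in>G - {1..k}. s (nn k))"
      by (rule sum.Int_Diff[OF G(1)])
    also have "(\<Sum>k\<in>G \<inter> {1..k}. s (nn k)) \<le> (\<Sum>k\<in>{1..k}. s (nn k))"
      using s_pos pos by (intro sum_mono2) (auto intro: less_imp_le)
    also have "(\<Sum>k\<in>G - {1..k}. s (nn k)) = (\<Sum>n\<in>?E. s n)"
      by (rule sum.reindex[symmetric, unfolded comp_def, OF inj_on_subset[OF inj]]) (use G(2) in auto)
    finally have lt: "(\<Sum>n\<in>D. s n) < (\<Sum>n\<in>?E. s n)" using G(3) by simp
    have "?E \<inter> initial_set nn k = {}"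
    proof -
      have "nn a \<noteq> nn b" if "a \<in> G - {1..k}" "b \<in> {1..k}" for a b
      proof
        assume "nn a = nn b"
        moreover have "a \<in> {1..}" "b \<in> {1..}" using that G(2) by auto
        ultimately have "a = b" by (rule inj_onD[OF inj])
        then show False using that by simp
      qed
      then show ?thesis by (fastforce simp: initial_set_def)
    qed
    moreover have "?E \<noteq> {}" using lt w by (metis less_le_not_le sum.empty)
    moreover have "transversal_norm r ?E \<le> 1"
      using G(2) by (intro transversal_norm_row[of _ _ i]) auto
    moreover have "finite ?E" "?E \<subseteq> {1..}" using G pos by auto
    ultimately show ?thesis using D lt by (metis less_imp_le)
  next
    case False
    then obtain b where b: "\<And>i G. finite G \<Longrightarrow> G \<subseteq> ?R i \<Longrightarrow> (\<Sum>k\<in>G. s (nn k)) \<le> b i"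
      by (metis not_less)
    have "s p / M > 0" using s_pos[OF p(1)] \<open>M \<ge> 1\<close> by simp
    then have "\<exists>k\<in>?R i. s (nn k) \<le> s p / M" for i
      using exists_term_le_of_bounded_sums[OF rows b] by blast
    then obtain \<kappa> where \<kappa>: "\<And>i. \<kappa> i \<in> ?R i" "\<And>i. s (nn (\<kappa> i)) \<le> s p / M" by metis
    from choice_set[OF \<kappa>(1)] obtain D k where D: "finite D" "D \<subseteq> initial_set nn k"
      "D = (\<lambda>i. nn (\<kappa> i)) ` {..<M}" "real M \<le> transversal_norm r D"
      by blast
    have "card D \<le> M" unfolding D(3) using card_image_le[of "{..<M}"] by fastforce
    have "(\<Sum>n\<in>D. s n) \<le> real (card D) * (s p / M)"
      using \<kappa>(2) D(3) by (intro sum_bounded_above) auto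
    also have "\<dots> \<le> real M * (s p / M)"
      using \<open>card D \<le> M\<close> \<open>s p / M > 0\<close> by (intro mult_right_mono) auto
    also have "\<dots> = s p" using \<open>M \<ge> 1\<close> by simp
    finally have "(\<Sum>n\<in>D. s n) \<le> (\<Sum>n\<in>{p}. s n)" by simp
    moreover have "{p} \<inter> initial_set nn k = {}" using p(2) by (auto simp: initial_set_def)
    moreover have "transversal_norm r {p} \<le> 1" by (rule transversal_norm_row) auto
    moreover have "finite {p}" "{p} \<subseteq> {1..}" "{p} \<noteq> {}" using p(1) by auto
    ultimately show ?thesis using D(2,4) by blast
  qed
qed

lemma not_strong_partially_greedy_induced_weight:
  fixes nn r :: "nat \<Rightarrow> nat"
  assumes inj: "inj_on nn {1..}" and pos: "\<forall>k\<ge>1. 1 \<le> nn k"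
    and p: "p \<ge> 1" "p \<notin> nn ` {1..}"
    and rows: "\<And>i. infinite {k \<in> {1..}. r (nn k) = i}"
    and s: "weight_sequence s"
  shows "\<not> strong_partially_greedy
    (comb_space (transversals r) :: ('f::real_normed_field, nat \<Rightarrow> 'f) normed_structure)
    unit_vec (coord (transversals r)) nn (induced_weight s)"
proof
  assume "strong_partially_greedy
    (comb_space (transversals r) :: ('f::real_normed_field, nat \<Rightarrow> 'f) normed_structure)
    unit_vec (coord (transversals r)) nn (induced_weight s)"
  from transversals.strong_partially_greedyD[OF pos this] obtain C where
    C: "\<And>k D E. D \<subseteq> initial_set nn k \<Longrightarrow> finite E \<Longrightarrow> E \<subseteq> {1..} \<Longrightarrow> E \<noteq> {} \<Longrightarrow>
    E \<inter> initial_set nn k = {} \<Longrightarrow> induced_weight s D \<le> induced_weight s E \<Longrightarrow>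
    transversal_norm r D \<le> C * transversal_norm r E"
    by blast
  obtain M :: nat where M: "real M > max 1 \<bar>C\<bar>" using reals_Archimedean2 by blast
  then have "M \<ge> 1" by linarith
  from exists_light_long_set[OF inj pos p rows s this] obtain k D E where
    D: "D \<subseteq> initial_set nn k" and E: "finite E" "E \<subseteq> {1..}" "E \<noteq> {}"
    and disj: "E \<inter> initial_set nn k = {}" and le: "(\<Sum>n\<in>D. s n) \<le> (\<Sum>n\<in>E. s n)"
    and norms: "real M \<le> transversal_norm r D" "transversal_norm r E \<le> 1"
    by blast
  have "finite D" "D \<subseteq> {1..}"
    using D pos finite_subset[OF D] by (force simp: initial_set_def)+
  then have "transversal_norm r D \<le> C * transversal_norm r E"
    using C[OF D E disj] induced_weight_le_iff[OF s _ _ E(1,2)] le by blast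
  also have "\<dots> \<le> \<bar>C\<bar> * 1"
    using norms(2) transversals.indicator_norm_nonneg[OF E(1,2)] by (intro mult_mono) auto
  finally show False using norms(1) M by simp
qed

text \<open>
  Decode the position of a term of the sequence as a pair of numbers and take the first one as its
  row; numbers that are not terms may be put into any row.
\<close>

lemma exists_rows:
  fixes nn :: "nat \<Rightarrow> nat"
  assumes "inj_on nn {1..}"
  shows "\<exists>r :: nat \<Rightarrow> nat. \<forall>i. infinite {k \<in> {1..}. r (nn k) = i}"
proof (intro exI allI)
  let ?r = "\<lambda>m. fst (prod_decode (inv_into {1..} nn m))"
  fix i
  have "(\<lambda>j. prod_encode (i, j)) ` {1..} \<subseteq> {k \<in> {1..}. ?r (nn k) = i}"
  proof (rule image_subsetI)
    fix j :: nat assume "j \<in> {1..}"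
    then have ge: "prod_encode (i, j) \<in> {1..}" using le_prod_encode_2[of j i] by simp
    have "?r (nn (prod_encode (i, j))) = i"
      by (simp only: inv_into_f_f[OF assms ge] prod_encode_inverse fst_conv)
    with ge show "prod_encode (i, j) \<in> {k \<in> {1..}. ?r (nn k) = i}" by blast
  qed
  moreover have "infinite ((\<lambda>j. prod_encode (i, j)) ` {1..})"
    using infinite_Ici by (subst finite_image_iff) (auto intro!: inj_onI)
  ultimately show "infinite {k \<in> {1..}. ?r (nn k) = i}" using infinite_super by blast
qed

lemma exists_basis_greedy_for_set_weight_only:
  fixes nn :: "nat \<Rightarrow> nat"
  assumes "strict_mono_on {1..} nn"
    and "\<forall>k\<ge>1. 1 \<le> nn k"
    and "nn ` {1..} \<noteq> {1..}"
  shows "\<exists>(X :: ('f::{real_normed_field,banach,second_countable_topology}, nat \<Rightarrow> 'f) normed_structure) e es.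
            banach_space X \<and> schauder_basis X e es \<and> one_unconditional X e \<and>
            (\<exists>\<omega>. set_weight \<omega> \<and> strong_partially_greedy X e es nn \<omega>) \<and>
            \<not> (\<exists>s. weight_sequence s \<and> strong_partially_greedy X e es nn (induced_weight s))"
proof -
  have inj: "inj_on nn {1..}" using assms(1) by (rule strict_mono_on_imp_inj_on)
  obtain r :: "nat \<Rightarrow> nat" where rows: "\<And>i. infinite {k \<in> {1..}. r (nn k) = i}"
    using exists_rows[OF inj] by blast
  obtain p where p: "p \<ge> 1" "p \<notin> nn ` {1..}" using assms(2,3) by fastforce
  let ?F = "transversals r"
  show ?thesis
    using transversals.banach_space_comb_space transversals.schauder_basis_comb_space
      transversals.one_unconditional_comb_space transversals.set_weight_indicator_weight
      transversals.strong_partially_greedy_indicator_weight[OF assms(2)]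
      not_strong_partially_greedy_induced_weight[OF inj assms(2) p rows]
    by (intro exI[of _ "comb_space ?F"] exI[of _ unit_vec] exI[of _ "coord ?F"]) blast
qed

theorem theorem9p20:
  fixes nn :: "nat \<Rightarrow> nat"
  assumes "strict_mono_on {1..} nn"
    and "\<forall>k\<ge>1. 1 \<le> nn k"
    and "nn ` {1..} \<noteq> {1..}"
  shows "(\<exists>(X :: (real, nat \<Rightarrow> real) normed_structure) e es.
            banach_space X \<and> schauder_basis X e es \<and> one_unconditional X e \<and>
            (\<exists>\<omega>. set_weight \<omega> \<and> strong_partially_greedy X e es nn \<omega>) \<and>
            \<not> (\<exists>s. weight_sequence s \<and> strong_partially_greedy X e es nn (induced_weight s))) \<and>
         (\<exists>(X :: (complex, nat \<Rightarrow> complex) normed_structure) e es.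
            banach_space X \<and> schauder_basis X e es \<and> one_unconditional X e \<and>
            (\<exists>\<omega>. set_weight \<omega> \<and> strong_partially_greedy X e es nn \<omega>) \<and>
            \<not> (\<exists>s. weight_sequence s \<and> strong_partially_greedy X e es nn (induced_weight s)))"
  using exists_basis_greedy_for_set_weight_only[OF assms] exists_basis_greedy_for_set_weight_only[OF assms]
  by (rule conjI)

end
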